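(* Let $(M,g)$ be a complete Riemannian manifold and $\Omega\subseteq M$ open. Fix $p>1$ and let $G\in C^\infty(\Omega)$ be such that (i) $-\Delta_pG\ge0$ on $\Omega$; (ii) $0\le G\le c<1$ on $\Omega$ for some constant $c$. Then, for any $\beta\ge0$, $$\int_\Omega\frac{|\nabla G|^p}{|G|^p}(-\log G)^{\beta p}|f|^p\,dV_g\le\left(\frac{p}{p-1}\right)^p\int_\Omega(-\log G)^{\beta p}|\nabla f|^p\,dV_g\qquad\forall f\in C_0^\infty(\Omega).$$
   Context: $\Delta_pG=\mathrm{div}(|\nabla G|^{p-2}\nabla G)$ is the $p$-Laplacian; the inequality $-\Delta_pG\ge0$ is understood in the weak sense where needed (i.e. $\int_\Omega|\nabla G|^{p-2}\langle\nabla G,\nabla\psi\rangle\,dV_g\ge0$ for all $0\le\psi\in C_0^\infty(\Omega)$). $C_0^\infty(\Omega)$ denotes smooth functions with compact support in $\Omega$. At points where $G=0$ (where necessarily $\nabla G=0$) the left-hand integrand is taken to be $0$, and the right-hand integrand is read in $[0,+\infty]$ with $0\cdot\infty=0$. *)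

theory Defs
  imports "HOL-Analysis.Analysis"
begin

section \<open>Smooth functions on open subsets of normed spaces\<close>

text \<open>All directional derivatives up to order k exist and are continuous; meant for open sets.\<close>

primrec Ck_on :: "nat \<Rightarrow> ('b::real_normed_vector \<Rightarrow> 'c::real_normed_vector) \<Rightarrow> 'b set \<Rightarrow> bool" where
  "Ck_on 0 h S \<longleftrightarrow> continuous_on S h"
| "Ck_on (Suc k) h S \<longleftrightarrow>
     (\<forall>y\<in>S. h differentiable (at y)) \<and>
     (\<forall>v. Ck_on k (\<lambda>y. frechet_derivative h (at y) v) S)"

definition smooth_on :: "'b::real_normed_vector set \<Rightarrow> ('b \<Rightarrow> 'c::real_normed_vector) \<Rightarrow> bool" where
  "smooth_on S h \<longleftrightarrow> (\<forall>k. Ck_on k h S)"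

section \<open>Smooth manifolds\<close>

text \<open>A manifold is a second countable Hausdorff type together with a (not necessarily maximal)
  smooth atlas. A chart is a pair of its domain and its coordinate map; the values of the
  coordinate map outside the domain carry no information.\<close>

type_synonym ('a, 'n) chart = "'a set \<times> ('a \<Rightarrow> real ^ 'n)"

abbreviation chart_dom :: "('a, 'n::finite) chart \<Rightarrow> 'a set" where
  "chart_dom \<equiv> fst"

abbreviation chart_map :: "('a, 'n::finite) chart \<Rightarrow> 'a \<Rightarrow> real ^ 'n" where
  "chart_map \<equiv> snd"

definition chart_inv :: "('a, 'n::finite) chart \<Rightarrow> real ^ 'n \<Rightarrow> 'a" where
  "chart_inv \<kappa> = inv_into (chart_dom \<kappa>) (chart_map \<kappa>)"

definition smooth_atlas ::
    "('a::{second_countable_topology,t2_space}, 'n::finite) chart set \<Rightarrow> bool" where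
  "smooth_atlas A \<longleftrightarrow>
     (\<Union>\<kappa>\<in>A. chart_dom \<kappa>) = UNIV \<and>
     (\<forall>\<kappa>\<in>A. open (chart_dom \<kappa>) \<and> open (chart_map \<kappa> ` chart_dom \<kappa>) \<and>
        homeomorphism (chart_dom \<kappa>) (chart_map \<kappa> ` chart_dom \<kappa>) (chart_map \<kappa>) (chart_inv \<kappa>)) \<and>
     (\<forall>\<kappa>\<in>A. \<forall>\<kappa>'\<in>A.
        smooth_on (chart_map \<kappa> ` (chart_dom \<kappa> \<inter> chart_dom \<kappa>')) (chart_map \<kappa>' \<circ> chart_inv \<kappa>))"

definition chart_at :: "('a, 'n::finite) chart set \<Rightarrow> 'a \<Rightarrow> ('a, 'n) chart" where
  "chart_at A x = (SOME \<kappa>. \<kappa> \<in> A \<and> x \<in> chart_dom \<kappa>)"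

definition smooth_fun ::
    "('a::topological_space, 'n::finite) chart set \<Rightarrow> 'a set \<Rightarrow> ('a \<Rightarrow> real) \<Rightarrow> bool" where
  "smooth_fun A \<Omega> f \<longleftrightarrow>
     (\<forall>\<kappa>\<in>A. smooth_on (chart_map \<kappa> ` (chart_dom \<kappa> \<inter> \<Omega>)) (f \<circ> chart_inv \<kappa>))"

text \<open>Functions on an open set are total functions whose values outside that set are
  irrelevant; hence the support is formed inside the set.\<close>

definition test_fun ::
    "('a::topological_space, 'n::finite) chart set \<Rightarrow> 'a set \<Rightarrow> ('a \<Rightarrow> real) \<Rightarrow> bool" where
  "test_fun A \<Omega> f \<longleftrightarrow>
     smooth_fun A \<Omega> f \<and>
     compact (closure {x \<in> \<Omega>. f x \<noteq> 0}) \<and> closure {x \<in> \<Omega>. f x \<noteq> 0} \<subseteq> \<Omega>"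

section \<open>Riemannian metrics\<close>

text \<open>A Riemannian metric is given by its component matrices in the charts: g \<kappa> x is the matrix
  of the inner product on the tangent space at x in the coordinate frame of \<kappa>. The last
  condition is the transformation law of a covariant 2-tensor, so that the components in
  different charts define the same inner product.\<close>

type_synonym ('a, 'n) metric_components = "('a, 'n) chart \<Rightarrow> 'a \<Rightarrow> real ^ 'n ^ 'n"

definition riemannian_metric ::
    "('a, 'n::finite) chart set \<Rightarrow> ('a, 'n) metric_components \<Rightarrow> bool" where
  "riemannian_metric A g \<longleftrightarrow>
     (\<forall>\<kappa>\<in>A. smooth_on (chart_map \<kappa> ` chart_dom \<kappa>) (\<lambda>y. g \<kappa> (chart_inv \<kappa> y))) \<and>
     (\<forall>\<kappa>\<in>A. \<forall>x\<in>chart_dom \<kappa>.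
        transpose (g \<kappa> x) = g \<kappa> x \<and> (\<forall>v. v \<noteq> 0 \<longrightarrow> 0 < v \<bullet> (g \<kappa> x *v v))) \<and>
     (\<forall>\<kappa>\<in>A. \<forall>\<kappa>'\<in>A. \<forall>x\<in>chart_dom \<kappa> \<inter> chart_dom \<kappa>'.
        let J = jacobian (chart_map \<kappa>' \<circ> chart_inv \<kappa>) (at (chart_map \<kappa> x))
        in g \<kappa> x = transpose J ** g \<kappa>' x ** J)"

text \<open>A tangent vector at x is represented by its components in the chart chosen at x.\<close>

definition tangent_inner ::
    "('a, 'n::finite) chart set \<Rightarrow> ('a, 'n) metric_components \<Rightarrow> 'a \<Rightarrow>
      real ^ 'n \<Rightarrow> real ^ 'n \<Rightarrow> real" where
  "tangent_inner A g x u v = u \<bullet> (g (chart_at A x) x *v v)"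

definition tangent_norm ::
    "('a, 'n::finite) chart set \<Rightarrow> ('a, 'n) metric_components \<Rightarrow> 'a \<Rightarrow> real ^ 'n \<Rightarrow> real" where
  "tangent_norm A g x v = sqrt (tangent_inner A g x v v)"

text \<open>The gradient has the components obtained by raising the index of the differential.\<close>

definition gradient ::
    "('a, 'n::finite) chart set \<Rightarrow> ('a, 'n) metric_components \<Rightarrow> ('a \<Rightarrow> real) \<Rightarrow> 'a \<Rightarrow> real ^ 'n" where
  "gradient A g f x =
     (let \<kappa> = chart_at A x
      in matrix_inv (g \<kappa> x) *v
           (\<chi> i. frechet_derivative (f \<circ> chart_inv \<kappa>) (at (chart_map \<kappa> x)) (axis i 1)))"

section \<open>Completeness\<close>

definition piecewise_C1_curve ::
    "('a::topological_space, 'n::finite) chart set \<Rightarrow> (real \<Rightarrow> 'a) \<Rightarrow> bool" where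
  "piecewise_C1_curve A \<gamma> \<longleftrightarrow>
     path \<gamma> \<and>
     (\<forall>\<kappa>\<in>A. \<forall>a b. {a..b} \<subseteq> {0..1} \<and> \<gamma> ` {a..b} \<subseteq> chart_dom \<kappa> \<longrightarrow>
        (chart_map \<kappa> \<circ> \<gamma>) piecewise_C1_differentiable_on {a..b})"

definition curve_length ::
    "('a, 'n::finite) chart set \<Rightarrow> ('a, 'n) metric_components \<Rightarrow> (real \<Rightarrow> 'a) \<Rightarrow> ennreal" where
  "curve_length A g \<gamma> =
     (\<integral>\<^sup>+t\<in>{0..1}. ennreal (tangent_norm A g (\<gamma> t)
        (vector_derivative (chart_map (chart_at A (\<gamma> t)) \<circ> \<gamma>) (at t))) \<partial>lborel)"

text \<open>The distance between different connected components is infinite.\<close>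

definition riemannian_dist ::
    "('a::topological_space, 'n::finite) chart set \<Rightarrow> ('a, 'n) metric_components \<Rightarrow>
      'a \<Rightarrow> 'a \<Rightarrow> ennreal" where
  "riemannian_dist A g x y =
     (INF \<gamma> \<in> {\<gamma>. piecewise_C1_curve A \<gamma> \<and> pathstart \<gamma> = x \<and> pathfinish \<gamma> = y}. curve_length A g \<gamma>)"

definition complete_riemannian_manifold ::
    "('a::{second_countable_topology,t2_space}, 'n::finite) chart set \<Rightarrow>
      ('a, 'n) metric_components \<Rightarrow> bool" where
  "complete_riemannian_manifold A g \<longleftrightarrow>
     smooth_atlas A \<and> riemannian_metric A g \<and>
     (\<forall>X :: nat \<Rightarrow> 'a.
        (\<forall>e>0. \<exists>N. \<forall>m\<ge>N. \<forall>n\<ge>N. riemannian_dist A g (X m) (X n) < e) \<longrightarrow>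
        (\<exists>x. (\<lambda>n. riemannian_dist A g (X n) x) \<longlonglongrightarrow> 0))"

section \<open>The Riemannian volume measure\<close>

text \<open>The measure is assembled from the coordinate densities sqrt (det g) along a countable cover
  by open sets V n that are relatively compact in chart domains, made disjoint in the order of
  the enumeration. Such covers exist by second countability, and by the change of variables formula
  the result does not depend on the chosen cover.\<close>

definition coordinate_cover ::
    "('a::topological_space, 'n::finite) chart set \<Rightarrow> (nat \<Rightarrow> ('a, 'n) chart \<times> 'a set) \<Rightarrow> bool" where
  "coordinate_cover A C \<longleftrightarrow>
     (\<forall>n. fst (C n) \<in> A \<and> open (snd (C n)) \<and> compact (closure (snd (C n))) \<and>
          closure (snd (C n)) \<subseteq> chart_dom (fst (C n))) \<and>
     (\<Union>n. snd (C n)) = UNIV"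

definition chart_volume ::
    "('a, 'n::finite) metric_components \<Rightarrow> ('a, 'n) chart \<Rightarrow> 'a set \<Rightarrow> ennreal" where
  "chart_volume g \<kappa> B =
     (\<integral>\<^sup>+y\<in>chart_map \<kappa> ` B. ennreal (sqrt (det (g \<kappa> (chart_inv \<kappa> y)))) \<partial>lborel)"

definition riemannian_volume ::
    "('a::topological_space, 'n::finite) chart set \<Rightarrow> ('a, 'n) metric_components \<Rightarrow> 'a measure" where
  "riemannian_volume A g =
     (let C = (SOME C. coordinate_cover A C)
      in measure_of UNIV (sets borel)
           (\<lambda>B. \<Sum>n. chart_volume g (fst (C n)) (B \<inter> (snd (C n) - (\<Union>m<n. snd (C m))))))"

section \<open>The p-Laplacian inequality and the logarithmic weight\<close>

text \<open>The weak form of the inequality 0 \<le> - div (|grad G|^(p-2) grad G).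
  Since 0 powr a = 0, the integrand vanishes where the gradient of G does, also for p < 2.\<close>

definition p_superharmonic ::
    "('a::topological_space, 'n::finite) chart set \<Rightarrow> ('a, 'n) metric_components \<Rightarrow>
      real \<Rightarrow> 'a set \<Rightarrow> ('a \<Rightarrow> real) \<Rightarrow> bool" where
  "p_superharmonic A g p \<Omega> G \<longleftrightarrow>
     (\<forall>\<psi>. test_fun A \<Omega> \<psi> \<and> (\<forall>x\<in>\<Omega>. 0 \<le> \<psi> x) \<longrightarrow>
        0 \<le> (LINT x:\<Omega>|riemannian_volume A g.
               tangent_norm A g x (gradient A g G x) powr (p - 2) *
               tangent_inner A g x (gradient A g G x) (gradient A g \<psi> x)))"

text \<open>The value of (- log t)^q in [0, \<infinity>] for 0 \<le> t < 1 and q \<ge> 0, with - log 0 = \<infinity> and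
  exponent 0 giving 1.\<close>

definition neg_log_pow :: "real \<Rightarrow> real \<Rightarrow> ennreal" where
  "neg_log_pow q t =
     (if t = 0 then (if q = 0 then 1 else \<infinity>) else ennreal ((- ln t) powr q))"

end

theory Submission
  imports Defs "HOL-Real_Asymp.Real_Asymp"
begin

text \<open>Put s = G + \<epsilon> with \<epsilon> so small that s < 1, and test the superharmonicity of G with
  \<psi> = ((f^2 + \<delta>)^(p/2) - \<delta>^(p/2)) s^(1 - p) (- log s)^(\<beta> p), a smooth stand-in for
  |f|^p G^(1 - p) (- log G)^(\<beta> p). Differentiating the logarithmic factor gives a term of
  favourable sign, which is dropped; the product of |\<nabla>G| and |\<nabla>f| is absorbed by Young's inequality for
  X^(p - 1) Y with X = sqrt (f^2 + \<delta>) |\<nabla>G| / s and Y = p/(p - 1) |\<nabla>f|, whose weights already give the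
  sharp constant. All integrals run over the compact support of f and are finite, so \<delta> \<rightarrow> 0 is
  elementary; \<epsilon> \<rightarrow> 0 is Fatou's lemma.\<close>

section \<open>Calculus of smooth functions\<close>

text \<open>Both shifts exist because test functions must be smooth: |f|^p need not be smooth at
  zeros of f, and G^(1 - p) is singular at zeros of G. The constant: differentiating s^(1 - p)
  yields -(p - 1) X^p, and Young's inequality turns the mixed term into (p - 1)^2 / p X^p + (p - 1)
  / p Y^p. The sum is (p - 1) / p (Y^p - X^p), so the common factor cancels. The p in Y = p / (p -
  1) |\<nabla>f| comes from differentiating |f|^p, the p - 1 from s^(1 - p). The order of the limits
  matters: for fixed \<epsilon> the coefficient of the \<delta>-error is bounded on the support of
  f, whereas it may blow up as \<epsilon> tends to 0. The geometric obstacle is that gradients are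
  written in a chart chosen separately at each point. Continuity of |\<nabla>G| and of inner
  products of gradients therefore rests on coordinate independence; together with finite volume of
  compact sets it gives integrability.\<close>

lemma Ck_on_cong:
  assumes "open S" "\<And>y. y \<in> S \<Longrightarrow> h y = h' y" "Ck_on k h S"
  shows "Ck_on k h' S"
  using assms(2,3)
proof (induction k arbitrary: h h')
  case 0
  then show ?case using continuous_on_cong[of S S h h'] by simp
next
  case (Suc k)
  have D: "(h' has_derivative frechet_derivative h (at y)) (at y)" if y: "y \<in> S" for y
  proof -
    have "(h has_derivative frechet_derivative h (at y)) (at y)"
      using Suc.prems(2) y by (simp add: frechet_derivative_works)
    then show ?thesis
      by (rule has_derivative_transform_within_open[OF _ \<open>open S\<close> y]) (rule Suc.prems(1))
  qed
  have "Ck_on k (\<lambda>y. frechet_derivative h' (at y) v) S" for v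
  proof (rule Suc.IH)
    show "Ck_on k (\<lambda>y. frechet_derivative h (at y) v) S"
      using Suc.prems(2) by simp
  qed (simp add: frechet_derivative_at[OF D])
  with D show ?case by (auto simp: differentiable_def)
qed

text \<open>Replaces the abstract \<open>frechet_derivative\<close> by any known formula for the
  derivative; openness of S makes agreement on S enough. The closure rules below feed their
  differentiation rules through this form.\<close>

lemma Ck_on_SucI:
  assumes "open S" "\<And>y. y \<in> S \<Longrightarrow> (h has_derivative D y) (at y)"
    and "\<And>v. Ck_on k (\<lambda>y. D y v) S"
  shows "Ck_on (Suc k) h S"
  unfolding Ck_on.simps
proof (intro conjI ballI allI)
  show "h differentiable at y" if "y \<in> S" for y
    using assms(2)[OF that] by (auto simp: differentiable_def)
  show "Ck_on k (\<lambda>y. frechet_derivative h (at y) v) S" for v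
    by (rule Ck_on_cong[OF assms(1) _ assms(3)])
       (simp add: frechet_derivative_at[OF assms(2), symmetric])
qed

lemma Ck_on_Suc_D:
  assumes "Ck_on (Suc k) h S"
  shows "y \<in> S \<Longrightarrow> (h has_derivative frechet_derivative h (at y)) (at y)"
    and "Ck_on k (\<lambda>y. frechet_derivative h (at y) v) S"
  using assms by (simp_all add: frechet_derivative_works)

text \<open>The recursion for \<open>Suc k\<close> does not mention \<open>Ck_on k\<close> of the
  function itself, yet the product rule leaves undifferentiated factors that need it.
  Differentiability supplies the continuity at the bottom.\<close>

lemma Ck_on_Suc_imp_Ck_on: "Ck_on (Suc k) h S \<Longrightarrow> Ck_on k h S"
proof (induction k arbitrary: h)
  case 0
  then show ?case
    by (auto intro!: differentiable_imp_continuous_on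
        simp: differentiable_on_def differentiable_at_withinI)
next
  case (Suc k)
  have "h differentiable at y" if "y \<in> S" for y
    using Suc.prems that by simp
  moreover have "Ck_on k (\<lambda>y. frechet_derivative h (at y) v) S" for v
    by (rule Suc.IH[OF Ck_on_Suc_D(2)[OF Suc.prems]])
  ultimately show ?case by simp
qed

lemma Ck_on_const: 
  assumes "open S" shows "Ck_on k (\<lambda>_. a) S"
proof (induction k arbitrary: a)
  case (Suc k)
  show ?case
    by (rule Ck_on_SucI[OF assms has_derivative_const Suc.IH])
qed simp

lemma Ck_on_add:
  assumes "open S" "Ck_on k h S" "Ck_on k h' S"
  shows "Ck_on k (\<lambda>y. h y + h' y) S"
  using assms(2,3)
proof (induction k arbitrary: h h')
  case (Suc k)
  show ?case
    by (rule Ck_on_SucI[OF assms(1) has_derivative_add[OF Ck_on_Suc_D(1) Ck_on_Suc_D(1)] Suc.IH])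
       (rule Suc.prems Ck_on_Suc_D(2)[OF Suc.prems(1)] Ck_on_Suc_D(2)[OF Suc.prems(2)] | assumption)+
qed (simp add: continuous_on_add)

lemma Ck_on_mult:
  fixes h h' :: "'b::real_normed_vector \<Rightarrow> real"
  assumes "open S" "Ck_on k h S" "Ck_on k h' S"
  shows "Ck_on k (\<lambda>y. h y * h' y) S"
  using assms(2,3)
proof (induction k arbitrary: h h')
  case (Suc k)
  show ?case
  proof (rule Ck_on_SucI[OF assms(1)])
    show "((\<lambda>y. h y * h' y) has_derivative
        (\<lambda>v. h y * frechet_derivative h' (at y) v + frechet_derivative h (at y) v * h' y)) (at y)"
      if "y \<in> S" for y
      using Suc.prems that by (intro has_derivative_mult Ck_on_Suc_D(1))
    show "Ck_on k (\<lambda>y. h y * frechet_derivative h' (at y) v + frechet_derivative h (at y) v * h' y) S"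
      for v
      by (intro Ck_on_add assms(1) Suc.IH Ck_on_Suc_imp_Ck_on[OF Suc.prems(1)]
          Ck_on_Suc_imp_Ck_on[OF Suc.prems(2)] Ck_on_Suc_D(2)[OF Suc.prems(1)]
          Ck_on_Suc_D(2)[OF Suc.prems(2)])
  qed
qed (simp add: continuous_on_mult)

lemma Ck_on_exp:
  fixes h :: "'b::real_normed_vector \<Rightarrow> real"
  assumes "open S" "Ck_on k h S"
  shows "Ck_on k (\<lambda>y. exp (h y)) S"
  using assms(2)
proof (induction k arbitrary: h)
  case (Suc k)
  show ?case
  proof (rule Ck_on_SucI[OF assms(1)])
    show "((\<lambda>y. exp (h y)) has_derivative (\<lambda>v. exp (h y) * frechet_derivative h (at y) v)) (at y)"
      if "y \<in> S" for y
      using has_derivative_exp[OF Ck_on_Suc_D(1)[OF Suc.prems that]] by (simp add: mult.commute)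
    show "Ck_on k (\<lambda>y. exp (h y) * frechet_derivative h (at y) v) S" for v
      by (intro Ck_on_mult assms(1) Suc.IH Ck_on_Suc_imp_Ck_on[OF Suc.prems]
          Ck_on_Suc_D(2)[OF Suc.prems])
  qed
qed (simp add: continuous_on_exp)

lemma Ck_on_ln:
  fixes h :: "'b::real_normed_vector \<Rightarrow> real"
  assumes "open S" "\<And>y. y \<in> S \<Longrightarrow> 0 < h y" "Ck_on k h S"
  shows "Ck_on k (\<lambda>y. ln (h y)) S"
  using assms(3)
proof (induction k)
  case 0
  with assms(2) show ?case by (force intro!: continuous_on_ln)
next
  case (Suc k)
  have IH: "Ck_on k (\<lambda>y. ln (h y)) S"
    by (intro Suc.IH Ck_on_Suc_imp_Ck_on[OF Suc.prems])
  show ?case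
  proof (rule Ck_on_SucI[OF assms(1)])
    \<comment> \<open>The factor 1 / h is written as \<open>exp (-1 * ln (h y))\<close>, so closure
      under \<open>exp\<close> and the induction hypothesis for \<open>ln\<close> cover it.\<close>
    show "((\<lambda>y. ln (h y)) has_derivative
        (\<lambda>v. exp (-1 * ln (h y)) * frechet_derivative h (at y) v)) (at y)"
      if "y \<in> S" for y
      using has_derivative_ln[OF _ Ck_on_Suc_D(1)[OF Suc.prems that]] assms(2)[OF that]
      by (simp add: mult.commute exp_minus)
    show "Ck_on k (\<lambda>y. exp (-1 * ln (h y)) * frechet_derivative h (at y) v) S" for v
      by (intro Ck_on_mult Ck_on_exp Ck_on_const assms(1) IH Ck_on_Suc_D(2)[OF Suc.prems])
  qed
qed

lemma Ck_on_powr: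
  fixes h :: "'b::real_normed_vector \<Rightarrow> real"
  assumes "open S" "\<And>y. y \<in> S \<Longrightarrow> 0 < h y" "Ck_on k h S"
  shows "Ck_on k (\<lambda>y. h y powr a) S"
proof (rule Ck_on_cong[OF assms(1)])
  show "exp (a * ln (h y)) = h y powr a" if "y \<in> S" for y
    using assms(2)[OF that] by (simp add: powr_def)
  show "Ck_on k (\<lambda>y. exp (a * ln (h y))) S"
    by (intro Ck_on_exp Ck_on_mult Ck_on_const Ck_on_ln assms)
qed

section \<open>Differentials and gradients\<close>

text \<open>The differential is separated from the index raising in \<open>gradient\<close> because
  it alone obeys a plain chain rule under change of chart.\<close>

definition coord_diff :: "('a, 'n::finite) chart \<Rightarrow> ('a \<Rightarrow> real) \<Rightarrow> 'a \<Rightarrow> real ^ 'n" where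
  "coord_diff \<kappa> u x = (\<chi> i. frechet_derivative (u \<circ> chart_inv \<kappa>) (at (chart_map \<kappa> x)) (axis i 1))"

lemma coord_diff_eqI:
  assumes "((u \<circ> chart_inv \<kappa>) has_derivative (\<lambda>v. d \<bullet> v)) (at (chart_map \<kappa> x))"
  shows "coord_diff \<kappa> u x = d"
  unfolding coord_diff_def frechet_derivative_at[OF assms, symmetric]
  by (simp add: vec_eq_iff inner_axis)

lemma has_derivative_coord_diff:
  assumes "(u \<circ> chart_inv \<kappa>) differentiable at (chart_map \<kappa> x)"
  shows "((u \<circ> chart_inv \<kappa>) has_derivative (\<lambda>v. coord_diff \<kappa> u x \<bullet> v)) (at (chart_map \<kappa> x))"
proof -
  let ?D = "frechet_derivative (u \<circ> chart_inv \<kappa>) (at (chart_map \<kappa> x))"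
  have D: "((u \<circ> chart_inv \<kappa>) has_derivative ?D) (at (chart_map \<kappa> x))"
    using assms by (simp add: frechet_derivative_works)
  interpret bounded_linear ?D by (rule has_derivative_bounded_linear[OF D])
  have "?D v = coord_diff \<kappa> u x \<bullet> v" for v
  proof -
    have "?D v = ?D (\<Sum>i\<in>UNIV. v $ i *\<^sub>R axis i 1)"
      using basis_expansion[of v] by (simp add: scalar_mult_eq_scaleR)
    also have "\<dots> = coord_diff \<kappa> u x \<bullet> v"
      by (simp add: sum scaleR coord_diff_def inner_vec_def mult.commute)
    finally show ?thesis .
  qed
  then have "?D = (\<lambda>v. coord_diff \<kappa> u x \<bullet> v)" ..
  with D show ?thesis by (simp only:)
qed

lemma gradient_coord_diff:
  "gradient A g u x = matrix_inv (g (chart_at A x) x) *v coord_diff (chart_at A x) u x"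
  by (simp add: gradient_def coord_diff_def Let_def)

section \<open>Linear algebra of the metric matrices\<close>

lemma invertible_if_positive_definite:
  fixes Q :: "real ^ 'n ^ 'n"
  assumes "\<And>v. v \<noteq> 0 \<Longrightarrow> 0 < v \<bullet> (Q *v v)"
  shows "invertible Q"
proof -
  have "v = 0" if "Q *v v = 0" for v
    using assms[of v] that by fastforce
  then have "\<exists>B. B ** Q = mat 1"
    by (simp add: matrix_left_invertible_ker)
  then show ?thesis by (simp add: invertible_left_inverse)
qed

lemma matrix_inv_solves:
  fixes Q :: "real ^ 'n ^ 'n"
  assumes "invertible Q"
  shows "Q *v (matrix_inv Q *v b) = b" and "Q *v x = b \<Longrightarrow> matrix_inv Q *v b = x"
proof -
  have *: "Q ** matrix_inv Q = mat 1 \<and> matrix_inv Q ** Q = mat 1"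
    using assms unfolding invertible_def matrix_inv_def by (rule someI_ex)
  show "Q *v (matrix_inv Q *v b) = b" 
    by (simp add: matrix_vector_mul_assoc *)
  show "matrix_inv Q *v b = x" if "Q *v x = b"
    unfolding that[symmetric] by (simp add: matrix_vector_mul_assoc *)
qed

lemma continuous_on_det:
  fixes Q :: "'b::topological_space \<Rightarrow> real ^ 'n ^ 'n"
  assumes "\<And>i j. continuous_on S (\<lambda>x. Q x $ i $ j)"
  shows "continuous_on S (\<lambda>x. det (Q x))"
  unfolding det_def by (intro continuous_intros assms)

text \<open>Cramer's rule writes the solution as a quotient of determinants, which are polynomials
  in the entries of the matrix and of the right-hand side.\<close>

lemma continuous_on_matrix_inv_vector:
  fixes Q :: "'b::topological_space \<Rightarrow> real ^ 'n ^ 'n" and b :: "'b \<Rightarrow> real ^ 'n"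
  assumes "continuous_on S Q" "continuous_on S b" "\<And>x. x \<in> S \<Longrightarrow> invertible (Q x)"
  shows "continuous_on S (\<lambda>x. matrix_inv (Q x) *v b x)"
proof -
  have Q: "continuous_on S (\<lambda>x. Q x $ i $ j)" for i j
    using assms(1) by (intro continuous_on_component)
  have b: "continuous_on S (\<lambda>x. b x $ i)" for i
    using assms(2) by (intro continuous_on_component)
  have "continuous_on S (\<lambda>x. \<chi> k. det (\<chi> i j. if j = k then b x $ i else Q x $ i $ j) / det (Q x))"
  proof (intro continuous_on_vec_lambda continuous_on_divide continuous_on_det)
    show "continuous_on S (\<lambda>x. (\<chi> i j. if j = k then b x $ i else Q x $ i $ j) $ i $ j)" for i j k
      using Q b by (cases "j = k") simp_all
  qed (use Q assms(3) in \<open>auto simp: invertible_det_nz\<close>)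
  moreover have "matrix_inv (Q x) *v b x =
      (\<chi> k. det (\<chi> i j. if j = k then b x $ i else Q x $ i $ j) / det (Q x))" if "x \<in> S" for x
    using cramer[of "Q x" "matrix_inv (Q x) *v b x" "b x"] matrix_inv_solves(1)[OF assms(3)[OF that]]
      assms(3)[OF that] by (simp add: invertible_det_nz)
  ultimately show ?thesis
    by (simp cong: continuous_on_cong)
qed

section \<open>Charts, smooth functions and coordinate independence\<close>

lemma chart_at_mem:
  assumes "smooth_atlas A"
  shows "chart_at A x \<in> A" and "x \<in> chart_dom (chart_at A x)"
proof -
  have "x \<in> (\<Union>\<kappa>\<in>A. chart_dom \<kappa>)"
    using assms by (simp add: smooth_atlas_def)
  then have "\<exists>\<kappa>. \<kappa> \<in> A \<and> x \<in> chart_dom \<kappa>" by blast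
  from someI_ex[OF this] show "chart_at A x \<in> A" "x \<in> chart_dom (chart_at A x)"
    by (simp_all add: chart_at_def)
qed

lemma smooth_atlasD:
  assumes "smooth_atlas A" "\<kappa> \<in> A"
  shows "open (chart_dom \<kappa>)" "open (chart_map \<kappa> ` chart_dom \<kappa>)"
    "homeomorphism (chart_dom \<kappa>) (chart_map \<kappa> ` chart_dom \<kappa>) (chart_map \<kappa>) (chart_inv \<kappa>)"
    "x \<in> chart_dom \<kappa> \<Longrightarrow> chart_inv \<kappa> (chart_map \<kappa> x) = x"
proof -
  show "open (chart_dom \<kappa>)" "open (chart_map \<kappa> ` chart_dom \<kappa>)" and
    hom: "homeomorphism (chart_dom \<kappa>) (chart_map \<kappa> ` chart_dom \<kappa>) (chart_map \<kappa>) (chart_inv \<kappa>)"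
    using assms by (simp_all add: smooth_atlas_def)
  show "x \<in> chart_dom \<kappa> \<Longrightarrow> chart_inv \<kappa> (chart_map \<kappa> x) = x"
    using hom by (rule homeomorphism_apply1)
qed

lemma open_chart_image:
  assumes "smooth_atlas A" "\<kappa> \<in> A" "open \<Omega>"
  shows "open (chart_map \<kappa> ` (chart_dom \<kappa> \<inter> \<Omega>))"
proof -
  have "openin (top_of_set (chart_map \<kappa> ` chart_dom \<kappa>)) (chart_map \<kappa> ` (chart_dom \<kappa> \<inter> \<Omega>))"
    by (rule homeomorphism_imp_open_map[OF smooth_atlasD(3)[OF assms(1,2)]])
       (use assms(3) in auto)
  then show ?thesis
    using smooth_atlasD(2)[OF assms(1,2)] openin_open_trans by blast
qed

lemma continuous_on_chart_map:
  assumes "smooth_atlas A" "\<kappa> \<in> A"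
  shows "continuous_on (chart_dom \<kappa> \<inter> \<Omega>) (chart_map \<kappa>)"
  using homeomorphism_cont1[OF smooth_atlasD(3)[OF assms]] by (rule continuous_on_subset) auto

lemma smooth_fun_Ck_on:
  "smooth_fun A \<Omega> u \<Longrightarrow> \<kappa> \<in> A \<Longrightarrow> Ck_on k (u \<circ> chart_inv \<kappa>) (chart_map \<kappa> ` (chart_dom \<kappa> \<inter> \<Omega>))"
  by (simp add: smooth_fun_def smooth_on_def)

lemma smooth_fun_differentiable:
  assumes "smooth_fun A \<Omega> u" "\<kappa> \<in> A" "x \<in> chart_dom \<kappa> \<inter> \<Omega>"
  shows "(u \<circ> chart_inv \<kappa>) differentiable at (chart_map \<kappa> x)"
  using smooth_fun_Ck_on[OF assms(1,2), of "Suc 0"] assms(3) by auto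

lemma continuous_on_if_chartwise:
  assumes "smooth_atlas A" "open \<Omega>" "\<And>\<kappa>. \<kappa> \<in> A \<Longrightarrow> continuous_on (chart_dom \<kappa> \<inter> \<Omega>) h"
  shows "continuous_on \<Omega> h"
proof -
  have "continuous_on (\<Union>\<kappa>\<in>A. chart_dom \<kappa> \<inter> \<Omega>) h"
    using smooth_atlasD(1)[OF assms(1)] assms(2,3) by (intro continuous_on_open_UN open_Int)
  moreover have "(\<Union>\<kappa>\<in>A. chart_dom \<kappa> \<inter> \<Omega>) = \<Omega>"
    using assms(1) by (auto simp: smooth_atlas_def)
  ultimately show ?thesis by simp
qed

lemma continuous_on_via_chart:
  assumes "smooth_atlas A" "\<kappa> \<in> A"
    "continuous_on (chart_map \<kappa> ` (chart_dom \<kappa> \<inter> \<Omega>)) (\<lambda>y. h (chart_inv \<kappa> y))"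
  shows "continuous_on (chart_dom \<kappa> \<inter> \<Omega>) h"
proof -
  have "continuous_on (chart_dom \<kappa> \<inter> \<Omega>) (\<lambda>x. h (chart_inv \<kappa> (chart_map \<kappa> x)))"
    by (rule continuous_on_compose2[OF assms(3) continuous_on_chart_map[OF assms(1,2)]]) simp
  then show ?thesis
    by (rule continuous_on_eq) (simp add: smooth_atlasD(4)[OF assms(1,2)])
qed

lemma smooth_fun_continuous_on:
  assumes "smooth_atlas A" "open \<Omega>" "smooth_fun A \<Omega> u"
  shows "continuous_on \<Omega> u"
proof (rule continuous_on_if_chartwise[OF assms(1,2)])
  fix \<kappa> assume \<kappa>: "\<kappa> \<in> A"
  show "continuous_on (chart_dom \<kappa> \<inter> \<Omega>) u"
    using smooth_fun_Ck_on[OF assms(3) \<kappa>, of 0]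
    by (intro continuous_on_via_chart[OF assms(1) \<kappa>]) (simp add: o_def)
qed

lemma continuous_on_coord_diff:
  assumes "smooth_atlas A" "\<kappa> \<in> A" "smooth_fun A \<Omega> u"
  shows "continuous_on (chart_dom \<kappa> \<inter> \<Omega>) (coord_diff \<kappa> u)"
  unfolding coord_diff_def
proof (intro continuous_on_vec_lambda)
  fix i
  have "continuous_on (chart_map \<kappa> ` (chart_dom \<kappa> \<inter> \<Omega>))
      (\<lambda>y. frechet_derivative (u \<circ> chart_inv \<kappa>) (at y) (axis i 1))"
    using smooth_fun_Ck_on[OF assms(3,2), of "Suc 0"] by simp
  then show "continuous_on (chart_dom \<kappa> \<inter> \<Omega>)
      (\<lambda>x. frechet_derivative (u \<circ> chart_inv \<kappa>) (at (chart_map \<kappa> x)) (axis i 1))"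
    by (rule continuous_on_compose2[OF _ continuous_on_chart_map[OF assms(1,2)]]) simp
qed

text \<open>The chain rule along the transition map: near the point, u read in the first chart is u
  read in the second chart after that map.\<close>

lemma coord_diff_transform:
  assumes A: "smooth_atlas A" and \<kappa>: "\<kappa> \<in> A" "\<kappa>' \<in> A"
    and x: "x \<in> chart_dom \<kappa>" "x \<in> chart_dom \<kappa>'" "x \<in> \<Omega>" and u: "smooth_fun A \<Omega> u"
  shows "coord_diff \<kappa> u x =
    transpose (jacobian (chart_map \<kappa>' \<circ> chart_inv \<kappa>) (at (chart_map \<kappa> x))) *v coord_diff \<kappa>' u x"
    (is "_ = transpose ?J *v ?d")
proof (rule coord_diff_eqI)
  let ?T = "chart_map \<kappa>' \<circ> chart_inv \<kappa>" and ?S = "chart_map \<kappa> ` (chart_dom \<kappa> \<inter> chart_dom \<kappa>')"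
  have T_x: "?T (chart_map \<kappa> x) = chart_map \<kappa>' x"
    by (simp add: smooth_atlasD(4)[OF A \<kappa>(1)] x)
  have "smooth_on ?S ?T"
    using A \<kappa> by (simp add: smooth_atlas_def)
  then have "Ck_on (Suc 0) ?T ?S" by (simp only: smooth_on_def)
  then have "?T differentiable at (chart_map \<kappa> x)"
    using x by auto
  then have "(?T has_derivative (\<lambda>v. ?J *v v)) (at (chart_map \<kappa> x))"
    by (simp only: jacobian_works)
  moreover have "((u \<circ> chart_inv \<kappa>') has_derivative (\<lambda>v. ?d \<bullet> v)) (at (?T (chart_map \<kappa> x)))"
    unfolding T_x using smooth_fun_differentiable[OF u \<kappa>(2)] x
    by (intro has_derivative_coord_diff) auto
  ultimately have "((u \<circ> chart_inv \<kappa>') \<circ> ?T has_derivative (\<lambda>v. ?d \<bullet> v) \<circ> (\<lambda>v. ?J *v v))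
      (at (chart_map \<kappa> x))"
    by (rule diff_chain_at)
  then have "(u \<circ> chart_inv \<kappa> has_derivative (\<lambda>v. ?d \<bullet> v) \<circ> (\<lambda>v. ?J *v v)) (at (chart_map \<kappa> x))"
  proof (rule has_derivative_transform_within_open)
    show "open ?S"
      by (rule open_chart_image[OF A \<kappa>(1) smooth_atlasD(1)[OF A \<kappa>(2)]])
    show "chart_map \<kappa> x \<in> ?S" using x by auto
    show "((u \<circ> chart_inv \<kappa>') \<circ> ?T) y = (u \<circ> chart_inv \<kappa>) y" if "y \<in> ?S" for y
      using that by (auto simp: smooth_atlasD(4)[OF A \<kappa>(1)] smooth_atlasD(4)[OF A \<kappa>(2)])
  qed
  then show "(u \<circ> chart_inv \<kappa> has_derivative (\<lambda>v. (transpose ?J *v ?d) \<bullet> v)) (at (chart_map \<kappa> x))"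
    by (simp add: o_def dot_lmul_matrix)
qed

lemma riemannian_metricD:
  assumes "riemannian_metric A g" "\<kappa> \<in> A" "x \<in> chart_dom \<kappa>"
  shows "transpose (g \<kappa> x) = g \<kappa> x" "v \<noteq> 0 \<Longrightarrow> 0 < v \<bullet> (g \<kappa> x *v v)" "invertible (g \<kappa> x)"
  using assms by (auto simp: riemannian_metric_def intro!: invertible_if_positive_definite)

text \<open>The chart \<open>chart_at A x\<close> may jump between neighbouring points, so
  continuity has to be seen in a fixed chart. Differentials pull back by the transpose of the
  Jacobian J and the metric by the transpose of J on one side and J on the other; hence J maps one
  raised vector to the other and the pairing is unchanged.\<close>

lemma tangent_inner_gradient_chart:
  assumes A: "smooth_atlas A" and g: "riemannian_metric A g" and \<kappa>: "\<kappa> \<in> A"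
    and x: "x \<in> chart_dom \<kappa>" "x \<in> \<Omega>" and u: "smooth_fun A \<Omega> u" and v: "smooth_fun A \<Omega> v"
  shows "tangent_inner A g x (gradient A g u x) (gradient A g v x) =
    (matrix_inv (g \<kappa> x) *v coord_diff \<kappa> u x) \<bullet> coord_diff \<kappa> v x"
proof -
  let ?\<kappa> = "chart_at A x"
  note \<kappa>' = chart_at_mem[OF A, of x]
  define J where "J = jacobian (chart_map ?\<kappa> \<circ> chart_inv \<kappa>) (at (chart_map \<kappa> x))"
  define X where "X = matrix_inv (g \<kappa> x) *v coord_diff \<kappa> u x"
  define Y where "Y = matrix_inv (g ?\<kappa> x) *v coord_diff ?\<kappa> u x"
  have inv: "invertible (g \<kappa> x)" "invertible (g ?\<kappa> x)"
    using riemannian_metricD(3)[OF g] \<kappa> \<kappa>' x by auto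
  have gJ: "g \<kappa> x = transpose J ** g ?\<kappa> x ** J"
    using g \<kappa> \<kappa>' x unfolding riemannian_metric_def J_def Let_def by blast
  have du: "coord_diff \<kappa> u x = transpose J *v coord_diff ?\<kappa> u x"
    unfolding J_def by (rule coord_diff_transform[OF A \<kappa> \<kappa>'(1) x(1) \<kappa>'(2) x(2) u])
  have dv: "coord_diff \<kappa> v x = transpose J *v coord_diff ?\<kappa> v x"
    unfolding J_def by (rule coord_diff_transform[OF A \<kappa> \<kappa>'(1) x(1) \<kappa>'(2) x(2) v])
  \<comment> \<open>Invertibility of J is read off the transformation law: the metric determinants
    differ by the factor (det J)^2, and the one in \<kappa> is nonzero.\<close>
  have "det (g \<kappa> x) = det J * det (g ?\<kappa> x) * det J"
    unfolding gJ by (simp add: det_mul det_transpose)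
  then have "det J \<noteq> 0"
    using inv(1) by (auto simp: invertible_det_nz)
  then have J_inv: "invertible (transpose J)"
    by (simp add: invertible_det_nz det_transpose)
  \<comment> \<open>Cancelling the transpose of J shows that \<open>J *v X\<close> solves the linear
    system whose unique solution is Y.\<close>
  have "transpose J *v (g ?\<kappa> x *v (J *v X)) = g \<kappa> x *v X"
    unfolding gJ by (simp only: matrix_vector_mul_assoc matrix_mul_assoc)
  also have "\<dots> = transpose J *v coord_diff ?\<kappa> u x"
    unfolding X_def du by (rule matrix_inv_solves(1)[OF inv(1)])
  finally have "g ?\<kappa> x *v (J *v X) = coord_diff ?\<kappa> u x"
    using matrix_inv_solves(2)[OF J_inv] by metis
  then have Y: "Y = J *v X"
    unfolding Y_def by (rule matrix_inv_solves(2)[OF inv(2)])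
  have "tangent_inner A g x (gradient A g u x) (gradient A g v x) = Y \<bullet> coord_diff ?\<kappa> v x"
    by (simp add: tangent_inner_def gradient_coord_diff matrix_inv_solves(1)[OF inv(2)] Y_def)
  also have "\<dots> = X \<bullet> (transpose J *v coord_diff ?\<kappa> v x)"
    unfolding Y by (simp add: inner_commute[of X] dot_lmul_matrix)
       (simp add: inner_commute)
  finally show ?thesis
    by (simp add: X_def dv)
qed

lemma continuous_on_tangent_inner_gradient:
  assumes A: "smooth_atlas A" and g: "riemannian_metric A g" and \<Omega>: "open \<Omega>"
    and u: "smooth_fun A \<Omega> u" and v: "smooth_fun A \<Omega> v"
  shows "continuous_on \<Omega> (\<lambda>x. tangent_inner A g x (gradient A g u x) (gradient A g v x))"
proof (rule continuous_on_if_chartwise[OF A \<Omega>])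
  fix \<kappa> assume \<kappa>: "\<kappa> \<in> A"
  have "Ck_on 0 (\<lambda>y. g \<kappa> (chart_inv \<kappa> y)) (chart_map \<kappa> ` chart_dom \<kappa>)"
    using g \<kappa> unfolding riemannian_metric_def smooth_on_def by blast
  then have "continuous_on (chart_map \<kappa> ` (chart_dom \<kappa> \<inter> \<Omega>)) (\<lambda>y. g \<kappa> (chart_inv \<kappa> y))"
    by (auto intro: continuous_on_subset)
  then have "continuous_on (chart_dom \<kappa> \<inter> \<Omega>) (g \<kappa>)"
    by (rule continuous_on_via_chart[OF A \<kappa>])
  then have "continuous_on (chart_dom \<kappa> \<inter> \<Omega>)
      (\<lambda>x. (matrix_inv (g \<kappa> x) *v coord_diff \<kappa> u x) \<bullet> coord_diff \<kappa> v x)"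
    using riemannian_metricD(3)[OF g \<kappa>]
    by (intro continuous_on_inner continuous_on_matrix_inv_vector
        continuous_on_coord_diff[OF A \<kappa> u] continuous_on_coord_diff[OF A \<kappa> v]) auto
  then show "continuous_on (chart_dom \<kappa> \<inter> \<Omega>)
      (\<lambda>x. tangent_inner A g x (gradient A g u x) (gradient A g v x))"
    by (rule continuous_on_eq) (use tangent_inner_gradient_chart[OF A g \<kappa> _ _ u v] in auto)
qed

lemma continuous_on_tangent_norm_gradient:
  assumes "smooth_atlas A" "riemannian_metric A g" "open \<Omega>" "smooth_fun A \<Omega> u"
  shows "continuous_on \<Omega> (\<lambda>x. tangent_norm A g x (gradient A g u x))"
  unfolding tangent_norm_def
  by (intro continuous_on_real_sqrt continuous_on_tangent_inner_gradient assms)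

section \<open>Pointwise algebra of the inner product and the product rule for gradients\<close>

lemma tangent_inner_linear:
  "tangent_inner A g x X (a *\<^sub>R Y + b *\<^sub>R Z) = a * tangent_inner A g x X Y + b * tangent_inner A g x X Z"
  "tangent_inner A g x (a *\<^sub>R Y + b *\<^sub>R Z) X = a * tangent_inner A g x Y X + b * tangent_inner A g x Z X"
  by (simp_all add: tangent_inner_def matrix_vector_right_distrib matrix_vector_mult_scaleR
      inner_add_left inner_add_right)

lemma tangent_inner_commute:
  assumes "smooth_atlas A" "riemannian_metric A g"
  shows "tangent_inner A g x X Y = tangent_inner A g x Y X"
  using riemannian_metricD(1)[OF assms(2) chart_at_mem[OF assms(1)], of x]
  by (metis dot_lmul_matrix inner_commute tangent_inner_def transpose_matrix_vector)

lemma tangent_inner_self_nonneg: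
  assumes "smooth_atlas A" "riemannian_metric A g"
  shows "0 \<le> tangent_inner A g x X X"
  using riemannian_metricD(2)[OF assms(2) chart_at_mem[OF assms(1)], of X x]
  by (cases "X = 0") (auto simp: tangent_inner_def)

lemma tangent_norm_nonneg:
  assumes "smooth_atlas A" "riemannian_metric A g"
  shows "0 \<le> tangent_norm A g x X"
  by (simp add: tangent_norm_def tangent_inner_self_nonneg[OF assms])

lemma tangent_inner_self:
  assumes "smooth_atlas A" "riemannian_metric A g"
  shows "tangent_inner A g x X X = tangent_norm A g x X ^ 2"
  by (simp add: tangent_norm_def tangent_inner_self_nonneg[OF assms])

lemma tangent_Cauchy_Schwarz:
  assumes A: "smooth_atlas A" "riemannian_metric A g"
  shows "\<bar>tangent_inner A g x X Y\<bar> \<le> tangent_norm A g x X * tangent_norm A g x Y"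
proof -
  define a b c where "a = tangent_inner A g x X X" and "b = tangent_inner A g x X Y"
    and "c = tangent_inner A g x Y Y"
  have "b\<^sup>2 \<le> a * c"
  proof (cases "Y = 0")
    case True
    then show ?thesis by (simp add: b_def c_def tangent_inner_def)
  next
    case False
    then have c: "0 < c"
      using riemannian_metricD(2)[OF A(2) chart_at_mem[OF A(1)], of Y x]
      by (simp add: c_def tangent_inner_def)
    \<comment> \<open>The vector c X - b Y is c times the component of X orthogonal to Y, scaled to
      avoid division; its squared length is c (a c - b^2).\<close>
    have "0 \<le> tangent_inner A g x (c *\<^sub>R X + (- b) *\<^sub>R Y) (c *\<^sub>R X + (- b) *\<^sub>R Y)"
      by (rule tangent_inner_self_nonneg[OF A])
    also have "\<dots> = c * (c * a + - b * b) + - b * (c * b + - b * c)"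
      unfolding tangent_inner_linear
      by (simp add: a_def b_def c_def tangent_inner_commute[OF A, of x Y X])
    also have "\<dots> = c * (a * c - b\<^sup>2)"
      by (simp add: power2_eq_square algebra_simps)
    finally show ?thesis
      using c by (simp add: zero_le_mult_iff)
  qed
  then have "sqrt (b\<^sup>2) \<le> sqrt (a * c)" by (rule real_sqrt_le_mono)
  then show ?thesis
    by (simp add: a_def b_def c_def tangent_norm_def real_sqrt_mult)
qed

text \<open>This is the shape of the regularized test function, with u = f and v = G. The outer
  functions are differentiated only at the values attained at x, so the shifted logarithm is handled
  inside its domain.\<close>

lemma gradient_mult_comp:
  assumes A: "smooth_atlas A" and x: "x \<in> \<Omega>"
    and u: "smooth_fun A \<Omega> u" and v: "smooth_fun A \<Omega> v"
    and F: "(F has_real_derivative F') (at (u x))" and H: "(H has_real_derivative H') (at (v x))"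
  shows "gradient A g (\<lambda>x. F (u x) * H (v x)) x =
    (H (v x) * F') *\<^sub>R gradient A g u x + (F (u x) * H') *\<^sub>R gradient A g v x"
proof -
  let ?\<kappa> = "chart_at A x"
  note \<kappa> = chart_at_mem[OF A, of x]
  let ?y = "chart_map ?\<kappa> x"
  have y: "chart_inv ?\<kappa> ?y = x"
    by (rule smooth_atlasD(4)[OF A \<kappa>])
  have du: "((\<lambda>z. u (chart_inv ?\<kappa> z)) has_derivative (\<lambda>h. coord_diff ?\<kappa> u x \<bullet> h)) (at ?y)"
    using has_derivative_coord_diff[OF smooth_fun_differentiable[OF u \<kappa>(1)]] \<kappa>(2) x
    by (simp add: o_def)
  have dv: "((\<lambda>z. v (chart_inv ?\<kappa> z)) has_derivative (\<lambda>h. coord_diff ?\<kappa> v x \<bullet> h)) (at ?y)"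
    using has_derivative_coord_diff[OF smooth_fun_differentiable[OF v \<kappa>(1)]] \<kappa>(2) x
    by (simp add: o_def)
  have 1: "((\<lambda>z. F (u (chart_inv ?\<kappa> z))) has_derivative (\<lambda>h. (coord_diff ?\<kappa> u x \<bullet> h) * F')) (at ?y)"
    by (rule DERIV_compose_FDERIV[OF _ du]) (simp only: y F)
  have 2: "((\<lambda>z. H (v (chart_inv ?\<kappa> z))) has_derivative (\<lambda>h. (coord_diff ?\<kappa> v x \<bullet> h) * H')) (at ?y)"
    by (rule DERIV_compose_FDERIV[OF _ dv]) (simp only: y H)
  have "coord_diff ?\<kappa> (\<lambda>x. F (u x) * H (v x)) x =
      (H (v x) * F') *\<^sub>R coord_diff ?\<kappa> u x + (F (u x) * H') *\<^sub>R coord_diff ?\<kappa> v x" (is "_ = ?d")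
  proof (rule coord_diff_eqI)
    have "(\<lambda>h. F (u x) * ((coord_diff ?\<kappa> v x \<bullet> h) * H') + (coord_diff ?\<kappa> u x \<bullet> h) * F' * H (v x)) =
        (\<lambda>h. ?d \<bullet> h)"
      by (simp add: fun_eq_iff inner_add_left mult_ac)
    then show "((\<lambda>x. F (u x) * H (v x)) \<circ> chart_inv ?\<kappa> has_derivative (\<lambda>h. ?d \<bullet> h)) (at ?y)"
      using has_derivative_mult[OF 1 2] unfolding o_def y by (simp only:)
  qed
  then show ?thesis
    by (simp add: gradient_coord_diff matrix_vector_right_distrib matrix_vector_mult_scaleR)
qed

section \<open>The volume measure\<close>

text \<open>Pulling back a ball whose closed version still fits into a chart image gives a
  relatively compact neighbourhood of each point; the Lindelof property extracts countably
  many.\<close>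

lemma coordinate_cover_exists:
  assumes A: "smooth_atlas A"
  shows "\<exists>C. coordinate_cover A C"
proof -
  have "\<exists>V. open V \<and> x \<in> V \<and> compact (closure V) \<and> closure V \<subseteq> chart_dom (chart_at A x)" for x
  proof -
    let ?\<kappa> = "chart_at A x"
    note \<kappa> = chart_at_mem[OF A, of x]
    note hom = smooth_atlasD(3)[OF A \<kappa>(1)]
    have op: "open (chart_map ?\<kappa> ` chart_dom ?\<kappa>)"
      by (rule smooth_atlasD(2)[OF A \<kappa>(1)])
    then obtain r where r: "0 < r" "cball (chart_map ?\<kappa> x) r \<subseteq> chart_map ?\<kappa> ` chart_dom ?\<kappa>"
      using \<kappa>(2) open_contains_cball by blast
    let ?V = "chart_inv ?\<kappa> ` ball (chart_map ?\<kappa> x) r" and ?K = "chart_inv ?\<kappa> ` cball (chart_map ?\<kappa> x) r"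
    have sub: "ball (chart_map ?\<kappa> x) r \<subseteq> chart_map ?\<kappa> ` chart_dom ?\<kappa>"
      using r(2) ball_subset_cball by blast
    have "openin (top_of_set (chart_dom ?\<kappa>)) ?V"
      by (rule homeomorphism_imp_open_map[OF homeomorphism_symD[OF hom]])
         (use op sub in \<open>auto simp: openin_open_eq\<close>)
    then have "open ?V"
      using smooth_atlasD(1)[OF A \<kappa>(1)] openin_open_trans by blast
    moreover have "x \<in> ?V"
      using r(1) smooth_atlasD(4)[OF A \<kappa>] centre_in_ball[of "chart_map ?\<kappa> x" r]
      by (metis imageI)
    moreover have K: "compact ?K"
      using homeomorphism_cont2[OF hom] r(2)
      by (intro compact_continuous_image) (auto intro: continuous_on_subset)
    \<comment> \<open>The compact set \<open>?K\<close> is closed because the space is Hausdorff, so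
      the closure formed in the whole manifold stays inside the chart.\<close>
    have cl: "closure ?V \<subseteq> ?K"
      using ball_subset_cball compact_imp_closed[OF K] by (intro closure_minimal) auto
    moreover have "compact (closure ?V)"
      using compact_Int_closed[OF K, of "closure ?V"] cl by (simp add: Int_absorb1)
    moreover have "?K \<subseteq> chart_dom ?\<kappa>"
      using image_mono[OF r(2), of "chart_inv ?\<kappa>"] homeomorphism_image2[OF hom] by simp
    ultimately show ?thesis
      using order_trans[OF cl] by (intro exI[of _ ?V] conjI)
  qed
  then obtain V where V: "\<And>x. open (V x)" "\<And>x. x \<in> V x" "\<And>x. compact (closure (V x))"
      "\<And>x. closure (V x) \<subseteq> chart_dom (chart_at A x)"
    by metis
  obtain \<F> where \<F>: "\<F> \<subseteq> range V" "countable \<F>" "\<Union>\<F> = \<Union>(range V)"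
    using Lindelof[of "range V"] V(1) by blast
  have UN: "\<Union>\<F> = UNIV" using \<F>(3) V(2) by blast
  then have "\<F> \<noteq> {}" by blast
  \<comment> \<open>Each set of the enumeration is traced back to a point, since a coordinate cover
    must also name a chart for it.\<close>
  have "\<exists>x. from_nat_into \<F> n = V x" for n
    using from_nat_into[OF \<open>\<F> \<noteq> {}\<close>, of n] \<F>(1) by blast
  then obtain X where X: "\<And>n. from_nat_into \<F> n = V (X n)" by metis
  have "(\<Union>n. V (X n)) = \<Union>(range (from_nat_into \<F>))" by (simp add: X)
  then have "(\<Union>n. V (X n)) = UNIV"
    using range_from_nat_into[OF \<open>\<F> \<noteq> {}\<close> \<F>(2)] UN by simp
  then have "coordinate_cover A (\<lambda>n. (chart_at A (X n), V (X n)))"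
    using V chart_at_mem[OF A] by (simp add: coordinate_cover_def)
  then show ?thesis by (rule exI[of "coordinate_cover A"])
qed

text \<open>The density sqrt (det g) is continuous, hence bounded, on the compact coordinate image
  of L. Enlarging B to L also makes the bounding set measurable, whatever B is.\<close>

lemma chart_volume_finite:
  assumes A: "smooth_atlas A" and g: "riemannian_metric A g" and \<kappa>: "\<kappa> \<in> A"
    and L: "compact L" "L \<subseteq> chart_dom \<kappa>" and B: "B \<subseteq> L"
  shows "chart_volume g \<kappa> B < \<infinity>"
proof -
  let ?L = "chart_map \<kappa> ` L"
  have cL: "compact ?L"
    using L homeomorphism_cont1[OF smooth_atlasD(3)[OF A \<kappa>]]
    by (intro compact_continuous_image) (auto intro: continuous_on_subset)
  have "Ck_on 0 (\<lambda>y. g \<kappa> (chart_inv \<kappa> y)) (chart_map \<kappa> ` chart_dom \<kappa>)"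
    using g \<kappa> unfolding riemannian_metric_def smooth_on_def by blast
  then have "continuous_on ?L (\<lambda>y. g \<kappa> (chart_inv \<kappa> y))"
    using L by (auto intro: continuous_on_subset)
  then have "continuous_on ?L (\<lambda>y. sqrt (det (g \<kappa> (chart_inv \<kappa> y))))"
    by (intro continuous_on_real_sqrt continuous_on_det continuous_on_component)
  then have "bounded ((\<lambda>y. sqrt (det (g \<kappa> (chart_inv \<kappa> y)))) ` ?L)"
    using compact_imp_bounded[OF compact_continuous_image[OF _ cL]] by blast
  then obtain b where b: "\<And>y. y \<in> ?L \<Longrightarrow> \<bar>sqrt (det (g \<kappa> (chart_inv \<kappa> y)))\<bar> \<le> b"
    unfolding bounded_iff by (metis imageI real_norm_def)
  have "chart_volume g \<kappa> B \<le> (\<integral>\<^sup>+y. ennreal b * indicator ?L y \<partial>lborel)"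
    unfolding chart_volume_def
  proof (intro nn_integral_mono)
    fix y
    show "ennreal (sqrt (det (g \<kappa> (chart_inv \<kappa> y)))) * indicator (chart_map \<kappa> ` B) y
        \<le> ennreal b * indicator ?L y"
    proof (cases "y \<in> chart_map \<kappa> ` B")
      case True
      then have "y \<in> ?L" using B by blast
      with b[OF this] show ?thesis by (auto simp: indicator_def intro!: ennreal_leI)
    qed simp
  qed
  also have "\<dots> = ennreal b * emeasure lborel ?L"
    using borel_compact[OF cL] by (simp add: nn_integral_cmult_indicator)
  also have "\<dots> < \<infinity>"
    using emeasure_bounded_finite[OF compact_imp_bounded[OF cL]] by (simp add: ennreal_mult_less_top)
  finally show ?thesis .
qed

lemma sets_riemannian_volume [simp]: "sets (riemannian_volume A g) = sets borel"
  by (simp add: riemannian_volume_def Let_def sets.sigma_sets_eq[of borel, simplified])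

text \<open>Countable additivity of the defining set function is not needed: if it failed, the junk
  value of the measure would be zero everywhere, and every measure is bounded by the set function.\<close>

lemma emeasure_riemannian_volume_compact:
  assumes A: "smooth_atlas A" and g: "riemannian_metric A g" and K: "compact K"
  shows "emeasure (riemannian_volume A g) K < \<infinity>"
proof -
  define C where "C = (SOME C. coordinate_cover A C)"
  define V where "V n = snd (C n)" for n
  have "coordinate_cover A C"
    unfolding C_def by (rule someI_ex[OF coordinate_cover_exists[OF A]])
  then have C: "fst (C n) \<in> A" "open (V n)" "compact (closure (V n))"
    "closure (V n) \<subseteq> chart_dom (fst (C n))" "(\<Union>n. V n) = UNIV" for n
    by (auto simp: coordinate_cover_def V_def)
  obtain D where "finite D" "K \<subseteq> (\<Union>n\<in>D. V n)"
    using compactE_image[OF K, of UNIV V] C(2,5) by auto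
  then obtain N where N: "K \<subseteq> (\<Union>n<N. V n)"
    using finite_nat_iff_bounded[of D] by blast
  let ?c = "\<lambda>n. chart_volume g (fst (C n)) (K \<inter> (V n - (\<Union>m<n. V m)))"
  \<comment> \<open>The sets are made disjoint in the order of enumeration, so once the first N of
    them cover K every later piece misses K and the series is a finite sum.\<close>
  have "?c n = 0" if "n \<notin> {..<N}" for n
  proof -
    have "K \<inter> (V n - (\<Union>m<n. V m)) = {}" using N that by fastforce
    then show ?thesis by (simp only: chart_volume_def) simp
  qed
  then have "(\<Sum>n. ?c n) = (\<Sum>n<N. ?c n)"
    by (intro suminf_finite) auto
  also have "\<dots> < \<infinity>"
  proof -
    have "?c n < \<infinity>" for n
      by (rule chart_volume_finite[OF A g C(1,3,4)]) (use closure_subset in blast)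
    then show ?thesis by simp
  qed
  finally have "(\<Sum>n. ?c n) < \<infinity>" .
  then show ?thesis
    unfolding riemannian_volume_def Let_def C_def[symmetric] emeasure_measure_of_conv V_def[symmetric]
    by simp
qed

lemma set_integrable_compact:
  fixes h :: "'a::{second_countable_topology,t2_space} \<Rightarrow> real"
  assumes "smooth_atlas A" "riemannian_metric A g" "compact K" "continuous_on K h"
  shows "set_integrable (riemannian_volume A g) K h"
proof -
  have K: "K \<in> sets borel"
    using assms(3) by (rule borel_compact)
  have "bounded (h ` K)"
    using compact_imp_bounded[OF compact_continuous_image[OF assms(4,3)]] .
  then obtain b where b: "\<And>x. x \<in> K \<Longrightarrow> norm (h x) \<le> b"
    unfolding bounded_iff by blast
  have "(\<lambda>x. indicator K x *\<^sub>R h x) \<in> borel_measurable borel"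
    by (rule borel_measurable_continuous_on_indicator[OF K assms(4)])
  then have "(\<lambda>x. indicator K x *\<^sub>R h x) \<in> borel_measurable (riemannian_volume A g)"
    by (simp cong: measurable_cong_sets)
  then show ?thesis
    unfolding set_integrable_def using b K emeasure_riemannian_volume_compact[OF assms(1-3)]
    by (intro integrableI_bounded_set[where A = K and B = b]) (auto simp: indicator_def)
qed

section \<open>The regularized inequality\<close>

text \<open>The conjugate exponents are p / (p - 1) and p. The coefficient (p - 1) / p is below 1,
  so a full X^p of opposite sign absorbs it and keeps the share 1 / p.\<close>

lemma Young_powr:
  fixes X Y p :: real
  assumes "1 < p" "0 \<le> X" "0 \<le> Y"
  shows "X powr (p - 1) * Y \<le> (p - 1) / p * X powr p + Y powr p / p"
proof -
  have "1 / (p / (p - 1)) + 1 / p = 1" "1 < p / (p - 1)"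
    using assms(1) by (simp_all add: field_simps)
  then have "X powr (p - 1) * Y \<le> (X powr (p - 1)) powr (p / (p - 1)) / (p / (p - 1)) + Y powr p / p"
    using assms by (intro Youngs_inequality) auto
  also have "(X powr (p - 1)) powr (p / (p - 1)) = X powr p"
    using assms(1) by (simp add: powr_powr)
  finally show ?thesis
    by (simp add: mult.commute)
qed

text \<open>The whole analytic estimate at one point. N and B are the lengths of the gradients of G
  and f, I is their inner product, t = f(x), s the shifted value of G, w the logarithmic weight and
  H' the derivative of s^(1 - p) w. The right side collects the \<delta>-error, the gradient of f,
  and the term to be bounded.\<close>

lemma regularized_integrand_bound:
  fixes N B I t s w p \<delta> H' :: real
  assumes p: "1 < p" and N: "0 \<le> N" and B: "0 \<le> B" and I: "\<bar>I\<bar> \<le> N * B"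
    and s: "0 < s" and w: "0 \<le> w" and \<delta>: "0 < \<delta>"
    and H': "H' \<le> - ((p - 1) * s powr (- p) * w)"
  shows "N powr (p - 2) *
      (s powr (1 - p) * w * (p * (t\<^sup>2 + \<delta>) powr (p / 2 - 1) * t) * I +
       ((t\<^sup>2 + \<delta>) powr (p / 2) - \<delta> powr (p / 2)) * H' * N\<^sup>2)
    \<le> (p - 1) * (\<delta> powr (p / 2) * (N powr p / s powr p * w)
        + (p / (p - 1)) powr p * (w * B powr p) / p
        - N powr p / s powr p * w * \<bar>t\<bar> powr p / p)"
proof (cases "N = 0")
  \<comment> \<open>Here \<open>0 powr (p - 2)\<close> and \<open>0 powr p\<close> are both 0, so
    the left side vanishes and only the nonnegative gradient term of f survives on the
    right.\<close>
  case True
  then show ?thesis using p w by simp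
next
  case False
  with N have N: "0 < N" by simp
  define U where "U = t\<^sup>2 + \<delta>"
  define X where "X = sqrt U * N / s"
  define Y where "Y = p / (p - 1) * B"
  define a where "a = N powr p / s powr p"
  have U: "0 < U" "t\<^sup>2 \<le> U" "\<delta> \<le> U"
    using \<delta> by (auto simp: U_def add_nonneg_pos)
  have X: "0 < X" and Y: "0 \<le> Y"
    using U N s p B by (simp_all add: X_def Y_def)
  have t_le: "\<bar>t\<bar> \<le> sqrt U"
    using U(2) by (metis real_sqrt_abs real_sqrt_le_mono)
  have sqrt_powr: "sqrt U powr q = U powr (q / 2)" for q
    using U by (simp add: powr_half_sqrt[symmetric] powr_powr)
  have N2: "N powr (p - 2) * N\<^sup>2 = N powr p"
    using N by (simp add: powr_add[symmetric] powr_numeral[symmetric] del: powr_numeral)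
  have N1: "N powr (p - 2) * N = N powr (p - 1)"
    using N powr_add[of N "p - 2" 1] by simp
  have a_s: "a = N powr p * s powr (- p)"
    by (simp add: a_def powr_minus_divide)
  have Yp: "Y powr p = (p / (p - 1)) powr p * B powr p"
    unfolding Y_def by (rule powr_mult)
  have Xp: "X powr p = U powr (p / 2) * a"
    using U N s by (simp add: X_def a_def powr_mult powr_divide sqrt_powr)
  have Xp1: "X powr (p - 1) = U powr (p / 2 - 1) * sqrt U * N powr (p - 1) * s powr (1 - p)"
  proof -
    have "U powr ((p - 1) / 2) = U powr (p / 2 - 1) * sqrt U"
      using U by (simp add: powr_half_sqrt[symmetric] powr_add[symmetric] diff_divide_distrib)
    moreover have "s powr (1 - p) = 1 / s powr (p - 1)"
      using powr_minus_divide[of s "p - 1"] by simp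
    moreover have "X powr (p - 1) = U powr ((p - 1) / 2) * N powr (p - 1) / s powr (p - 1)"
      using U N s by (simp add: X_def powr_mult powr_divide sqrt_powr)
    ultimately show ?thesis by simp
  qed
  have "N powr (p - 2) * (s powr (1 - p) * w * (p * U powr (p / 2 - 1) * t) * I)
      = (N powr (p - 2) * s powr (1 - p) * w * p * U powr (p / 2 - 1)) * (t * I)"
    by (simp add: mult_ac)
  \<comment> \<open>Replacing t by sqrt U completes U^(p/2 - 1) to U^((p - 1)/2), exactly the power
    of U contained in X^(p - 1).\<close>
  also have "\<dots> \<le> (N powr (p - 2) * s powr (1 - p) * w * p * U powr (p / 2 - 1)) * (sqrt U * (N * B))"
  proof (rule mult_left_mono)
    have "t * I \<le> \<bar>t\<bar> * \<bar>I\<bar>" by (simp add: abs_mult[symmetric])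
    also have "\<dots> \<le> sqrt U * (N * B)"
      using t_le I U by (intro mult_mono) auto
    finally show "t * I \<le> sqrt U * (N * B)" .
  qed (use w p in simp)
  also have "\<dots> = (p - 1) * w * (X powr (p - 1) * Y)"
    using p by (simp add: Xp1 Y_def N1[symmetric] mult_ac)
  also have "\<dots> \<le> (p - 1) * w * ((p - 1) / p * X powr p + Y powr p / p)"
    using p w X Y by (intro mult_left_mono Young_powr) auto
  finally have 1: "N powr (p - 2) * (s powr (1 - p) * w * (p * U powr (p / 2 - 1) * t) * I)
      \<le> (p - 1) * w * ((p - 1) / p * X powr p + Y powr p / p)" .
  have "N powr (p - 2) * ((U powr (p / 2) - \<delta> powr (p / 2)) * H' * N\<^sup>2)
      = (U powr (p / 2) - \<delta> powr (p / 2)) * N powr p * H'"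
    by (simp add: N2[symmetric] mult_ac)
  also have "\<dots> \<le> (U powr (p / 2) - \<delta> powr (p / 2)) * N powr p * (- ((p - 1) * s powr (- p) * w))"
    using U \<delta> p by (intro mult_left_mono H' mult_nonneg_nonneg) (auto intro!: powr_mono2)
  also have "\<dots> = - ((p - 1) * w * ((U powr (p / 2) - \<delta> powr (p / 2)) * a))"
    unfolding a_s by (simp only: mult_minus_right mult_minus_left mult_ac)
  finally have 2: "N powr (p - 2) * ((U powr (p / 2) - \<delta> powr (p / 2)) * H' * N\<^sup>2)
      \<le> - ((p - 1) * w * ((U powr (p / 2) - \<delta> powr (p / 2)) * a))" .
  \<comment> \<open>Only the share of X^p that survives is weakened from U to t^2, so the
    cancellation against Young's term is exact.\<close>
  have "\<bar>t\<bar> powr p \<le> U powr (p / 2)"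
    using t_le p powr_mono2[of p "\<bar>t\<bar>" "sqrt U"] by (simp add: sqrt_powr)
  then have "a * \<bar>t\<bar> powr p / p \<le> a * U powr (p / 2) / p"
    using p by (intro divide_right_mono mult_left_mono) (auto simp: a_def)
  moreover have "(p - 1) / p * X powr p = X powr p - a * U powr (p / 2) / p"
    using p by (simp add: Xp field_simps)
  ultimately have 3: "(p - 1) / p * X powr p + Y powr p / p - (U powr (p / 2) - \<delta> powr (p / 2)) * a
      \<le> \<delta> powr (p / 2) * a + Y powr p / p - a * \<bar>t\<bar> powr p / p"
    by (simp add: Xp algebra_simps)
  have "N powr (p - 2) * (s powr (1 - p) * w * (p * U powr (p / 2 - 1) * t) * I +
       (U powr (p / 2) - \<delta> powr (p / 2)) * H' * N\<^sup>2)
     \<le> (p - 1) * w * ((p - 1) / p * X powr p + Y powr p / p - (U powr (p / 2) - \<delta> powr (p / 2)) * a)"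
    using 1 2 by (simp add: right_diff_distrib distrib_left)
  also have "\<dots> \<le> (p - 1) * w * (\<delta> powr (p / 2) * a + Y powr p / p - a * \<bar>t\<bar> powr p / p)"
    using p w by (intro mult_left_mono 3) auto
  also have "\<dots> = (p - 1) * (\<delta> powr (p / 2) * (a * w)
        + (p / (p - 1)) powr p * (w * B powr p) / p - a * w * \<bar>t\<bar> powr p / p)"
    unfolding Yp by (simp add: algebra_simps)
  finally show ?thesis by (simp only: U_def a_def)
qed

text \<open>An upper bound on the derivative suffices, because it gets multiplied by the nonnegative
  factor (f^2 + \<delta>)^(p/2) - \<delta>^(p/2). The logarithmic weight decreases in s for \<beta>
  \<ge> 0, which fixes the sign of the dropped term.\<close>

lemma log_weight_deriv_bound:
  fixes p \<beta> s :: real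
  assumes "0 < s" "s < 1" "1 < p" "0 \<le> \<beta>"
  obtains H' where "((\<lambda>s. s powr (1 - p) * (- ln s) powr (\<beta> * p)) has_real_derivative H') (at s)"
    and "H' \<le> - ((p - 1) * s powr (- p) * (- ln s) powr (\<beta> * p))"
proof -
  have L: "0 < - ln s" using assms by simp
  let ?H' = "((1 - p) * s powr (- p)) * (- ln s) powr (\<beta> * p) +
    (\<beta> * p * (- ln s) powr (\<beta> * p - 1) * (- inverse s)) * s powr (1 - p)"
  have 1: "((\<lambda>s. s powr (1 - p)) has_real_derivative (1 - p) * s powr (- p)) (at s)"
    using has_real_derivative_powr[OF assms(1), of "1 - p"] by simp
  have "((\<lambda>s. - ln s) has_real_derivative - inverse s) (at s)"
    using assms(1) by (auto intro!: derivative_eq_intros simp: divide_inverse)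
  then have 2: "((\<lambda>s. (- ln s) powr (\<beta> * p)) has_real_derivative
      \<beta> * p * (- ln s) powr (\<beta> * p - 1) * (- inverse s)) (at s)"
    by (rule DERIV_chain2[where f = "\<lambda>z. z powr (\<beta> * p)" and g = "\<lambda>s. - ln s"
          and x = s, OF has_real_derivative_powr[OF L]])
  have "0 \<le> \<beta> * p * (- ln s) powr (\<beta> * p - 1) * inverse s * s powr (1 - p)"
    using assms by (intro mult_nonneg_nonneg) auto
  then have "?H' \<le> - ((p - 1) * s powr (- p) * (- ln s) powr (\<beta> * p))"
    by (simp add: algebra_simps)
  with DERIV_mult[OF 1 2] show thesis by (rule that)
qed

text \<open>Positivity of \<delta>, of G + \<epsilon> and of -log (G + \<epsilon>) keeps every power
  away from its singular base 0. Subtracting the constant \<open>\<delta> powr q\<close> makes the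
  function vanish wherever f does, so its support lies in that of f.\<close>

lemma test_fun_regularized:
  assumes A: "smooth_atlas A" and \<Omega>: "open \<Omega>" and G: "smooth_fun A \<Omega> G" and f: "test_fun A \<Omega> f"
    and G_bounds: "\<And>x. x \<in> \<Omega> \<Longrightarrow> 0 < G x + \<epsilon>" "\<And>x. x \<in> \<Omega> \<Longrightarrow> G x + \<epsilon> < 1" and \<delta>: "0 < \<delta>"
  shows "test_fun A \<Omega> (\<lambda>x. (((f x)\<^sup>2 + \<delta>) powr q - \<delta> powr q) *
      ((G x + \<epsilon>) powr r * (- ln (G x + \<epsilon>)) powr s))" (is "test_fun A \<Omega> ?\<psi>")
proof -
  have f': "smooth_fun A \<Omega> f" using f by (simp add: test_fun_def)
  let ?K = "closure {x \<in> \<Omega>. f x \<noteq> 0}"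
  have "smooth_fun A \<Omega> ?\<psi>"
    unfolding smooth_fun_def smooth_on_def o_def
  proof (intro ballI allI)
    fix \<kappa> k assume \<kappa>: "\<kappa> \<in> A"
    let ?S = "chart_map \<kappa> ` (chart_dom \<kappa> \<inter> \<Omega>)"
    have S: "open ?S" by (rule open_chart_image[OF A \<kappa> \<Omega>])
    have f_Ck: "Ck_on k (\<lambda>y. f (chart_inv \<kappa> y)) ?S"
      using smooth_fun_Ck_on[OF f' \<kappa>] by (simp add: o_def)
    have G_Ck: "Ck_on k (\<lambda>y. G (chart_inv \<kappa> y)) ?S"
      using smooth_fun_Ck_on[OF G \<kappa>] by (simp add: o_def)
    have in_\<Omega>: "chart_inv \<kappa> y \<in> \<Omega>" if "y \<in> ?S" for y
      using that by (auto simp: smooth_atlasD(4)[OF A \<kappa>])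
    \<comment> \<open>Squares, differences and signs are spelled as products and sums to match the
      closure rules for \<open>Ck_on\<close>.\<close>
    have "Ck_on k (\<lambda>y. ((f (chart_inv \<kappa> y) * f (chart_inv \<kappa> y) + \<delta>) powr q + - (\<delta> powr q)) *
        ((G (chart_inv \<kappa> y) + \<epsilon>) powr r * (-1 * ln (G (chart_inv \<kappa> y) + \<epsilon>)) powr s)) ?S"
    proof (intro Ck_on_mult[OF S] Ck_on_add[OF S] Ck_on_powr[OF S] Ck_on_ln[OF S] Ck_on_const[OF S] f_Ck G_Ck)
      fix y assume "y \<in> ?S"
      then have y: "chart_inv \<kappa> y \<in> \<Omega>" by (rule in_\<Omega>)
      show "0 < f (chart_inv \<kappa> y) * f (chart_inv \<kappa> y) + \<delta>"
        using \<delta> by (simp add: add_nonneg_pos)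
      show "0 < G (chart_inv \<kappa> y) + \<epsilon>" "0 < G (chart_inv \<kappa> y) + \<epsilon>"
        by (rule G_bounds(1)[OF y])+
      show "0 < - 1 * ln (G (chart_inv \<kappa> y) + \<epsilon>)"
        using G_bounds[OF y] by simp
    qed
    then show "Ck_on k (\<lambda>y. (((f (chart_inv \<kappa> y))\<^sup>2 + \<delta>) powr q - \<delta> powr q) *
        ((G (chart_inv \<kappa> y) + \<epsilon>) powr r * (- ln (G (chart_inv \<kappa> y) + \<epsilon>)) powr s)) ?S"
      by (simp add: power2_eq_square)
  qed
  moreover have sub: "closure {x \<in> \<Omega>. ?\<psi> x \<noteq> 0} \<subseteq> ?K"
    by (intro closure_mono) auto
  moreover have K: "compact ?K" "?K \<subseteq> \<Omega>"
    using f by (simp_all add: test_fun_def)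
  moreover have "compact (closure {x \<in> \<Omega>. ?\<psi> x \<noteq> 0})"
    using compact_Int_closed[OF K(1) closed_closure[of "{x \<in> \<Omega>. ?\<psi> x \<noteq> 0}"]] sub
    by (simp only: Int_absorb1)
  ultimately show ?thesis
    unfolding test_fun_def by blast
qed

text \<open>For p < 2 the factor |\<nabla>G|^(p - 2) is unbounded near critical points of G, so the
  integrand need not be continuous. Cauchy-Schwarz dominates it by |\<nabla>G|^(p - 1)
  |\<nabla>\<psi>|, which is continuous because p > 1 and is integrable on K.\<close>

lemma integrable_p_Laplacian_pairing:
  assumes A: "smooth_atlas A" and g: "riemannian_metric A g" and \<Omega>: "open \<Omega>" and p: "1 < p"
    and G: "smooth_fun A \<Omega> G" and \<psi>: "smooth_fun A \<Omega> \<psi>" and K: "compact K" "K \<subseteq> \<Omega>"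
    and zero: "\<And>x. x \<in> \<Omega> - K \<Longrightarrow> gradient A g \<psi> x = 0"
  shows "set_integrable (riemannian_volume A g) \<Omega>
    (\<lambda>x. tangent_norm A g x (gradient A g G x) powr (p - 2) *
      tangent_inner A g x (gradient A g G x) (gradient A g \<psi> x))"
proof -
  let ?M = "riemannian_volume A g"
  let ?N = "\<lambda>x. tangent_norm A g x (gradient A g G x)"
  let ?P = "\<lambda>x. tangent_norm A g x (gradient A g \<psi> x)"
  let ?I = "\<lambda>x. tangent_inner A g x (gradient A g G x) (gradient A g \<psi> x)"
  note cont = continuous_on_tangent_norm_gradient[OF A g \<Omega>]
  have N: "continuous_on \<Omega> ?N" and P: "continuous_on \<Omega> ?P" and I: "continuous_on \<Omega> ?I"
    by (rule cont[OF G] cont[OF \<psi>] continuous_on_tangent_inner_gradient[OF A g \<Omega> G \<psi>])+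
  have \<Omega>': "\<Omega> \<in> sets borel" using \<Omega> by simp
  have "continuous_on K (\<lambda>x. ?N x powr (p - 1) * ?P x)"
    using K(2) p N P
    by (intro continuous_on_mult continuous_on_powr' continuous_on_const)
       (auto intro: continuous_on_subset simp: tangent_norm_nonneg[OF A g])
  then have bound: "integrable ?M (\<lambda>x. indicator K x *\<^sub>R (?N x powr (p - 1) * ?P x))"
    using set_integrable_compact[OF A g K(1)] by (simp add: set_integrable_def)
  have "(\<lambda>x. (indicator \<Omega> x *\<^sub>R ?N x) powr (p - 2) * (indicator \<Omega> x *\<^sub>R ?I x)) \<in> borel_measurable borel"
    using borel_measurable_continuous_on_indicator[OF \<Omega>' N]
      borel_measurable_continuous_on_indicator[OF \<Omega>' I] by measurable
  \<comment> \<open>Cutting off each factor separately gives measurability; off \<Omega> the product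
    is 0 in both forms.\<close>
  also have "(\<lambda>x. (indicator \<Omega> x *\<^sub>R ?N x) powr (p - 2) * (indicator \<Omega> x *\<^sub>R ?I x)) =
      (\<lambda>x. indicator \<Omega> x *\<^sub>R (?N x powr (p - 2) * ?I x))"
    by (auto simp: fun_eq_iff indicator_def)
  finally have meas: "(\<lambda>x. indicator \<Omega> x *\<^sub>R (?N x powr (p - 2) * ?I x)) \<in> borel_measurable ?M"
    by (simp cong: measurable_cong_sets)
  have le: "norm (indicator \<Omega> x *\<^sub>R (?N x powr (p - 2) * ?I x)) \<le>
      norm (indicator K x *\<^sub>R (?N x powr (p - 1) * ?P x))" for x
  proof (cases "x \<in> K")
    case True
    have "\<bar>?N x powr (p - 2) * ?I x\<bar> \<le> ?N x powr (p - 2) * (?N x * ?P x)"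
      unfolding abs_mult using tangent_Cauchy_Schwarz[OF A g] by (simp add: mult_left_mono)
    also have "\<dots> = ?N x powr (p - 1) * ?P x"
      using powr_add[of "?N x" "p - 2" 1] tangent_norm_nonneg[OF A g, of x "gradient A g G x"]
      by (cases "?N x = 0") simp_all
    finally show ?thesis
      using True K(2) tangent_norm_nonneg[OF A g, of x "gradient A g \<psi> x"]
      by (auto simp: indicator_def abs_mult)
  next
    case False
    then show ?thesis
      using zero[of x] by (auto simp: indicator_def tangent_inner_def)
  qed
  show ?thesis
    unfolding set_integrable_def
    by (rule Bochner_Integration.integrable_bound[OF bound meas AE_I2[OF le]])
qed

lemma le_if_le_add_small:
  fixes X Y Z :: real
  assumes "\<And>e. 0 < e \<Longrightarrow> X \<le> e * Y + Z"
  shows "X \<le> Z"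
proof -
  have lim: "((\<lambda>e. e * Y + Z) \<longlongrightarrow> 0 * Y + Z) (at_right 0)"
    by (intro tendsto_intros)
  have "eventually (\<lambda>e. X \<le> e * Y + Z) (at_right 0)"
    by (rule eventually_mono[OF eventually_at_right_less assms])
  from tendsto_lowerbound[OF lim this] show ?thesis by simp
qed

text \<open>The case of fixed \<epsilon>, with \<delta> already removed. Working over the compact
  support K keeps all integrals finite, so terms can be subtracted; the two integrability claims
  later turn the real integrals into integrals in [0, \<infinity>].\<close>

lemma regularized_inequality:
  fixes A :: "('a::{second_countable_topology,t2_space}, 'n::finite) chart set"
  assumes A: "smooth_atlas A" and g: "riemannian_metric A g" and \<Omega>: "open \<Omega>" and p: "1 < p"
    and G: "smooth_fun A \<Omega> G" and super: "p_superharmonic A g p \<Omega> G"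
    and s_bounds: "\<And>x. x \<in> \<Omega> \<Longrightarrow> 0 < G x + \<epsilon>" "\<And>x. x \<in> \<Omega> \<Longrightarrow> G x + \<epsilon> < 1"
    and \<beta>: "0 \<le> \<beta>" and f: "test_fun A \<Omega> f"
  defines "K \<equiv> closure {x \<in> \<Omega>. f x \<noteq> 0}"
    and "a \<equiv> \<lambda>x. tangent_norm A g x (gradient A g G x) powr p / (G x + \<epsilon>) powr p *
      (- ln (G x + \<epsilon>)) powr (\<beta> * p)"
    and "b \<equiv> \<lambda>x. (- ln (G x + \<epsilon>)) powr (\<beta> * p) * tangent_norm A g x (gradient A g f x) powr p"
  shows "set_integrable (riemannian_volume A g) K (\<lambda>x. a x * \<bar>f x\<bar> powr p)"
    and "set_integrable (riemannian_volume A g) K b"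
    and "(LINT x:K|riemannian_volume A g. a x * \<bar>f x\<bar> powr p)
      \<le> (p / (p - 1)) powr p * (LINT x:K|riemannian_volume A g. b x)"
proof -
  let ?M = "riemannian_volume A g"
  let ?N = "\<lambda>x. tangent_norm A g x (gradient A g G x)"
  let ?B = "\<lambda>x. tangent_norm A g x (gradient A g f x)"
  let ?C = "(p / (p - 1)) powr p"
  have f': "smooth_fun A \<Omega> f" and K: "compact K" "K \<subseteq> \<Omega>"
    using f by (simp_all add: test_fun_def K_def)
  have cG: "continuous_on K G" and cf: "continuous_on K f"
    using smooth_fun_continuous_on[OF A \<Omega>] G f' K(2) by (auto intro: continuous_on_subset)
  have cN: "continuous_on K ?N" and cB: "continuous_on K ?B"
    using continuous_on_tangent_norm_gradient[OF A g \<Omega>] G f' K(2) by (auto intro: continuous_on_subset)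
  have s_pos: "0 < G x + \<epsilon>" "0 < - ln (G x + \<epsilon>)" if "x \<in> \<Omega>" for x
    using s_bounds[OF that] by simp_all
  have "continuous_on K (\<lambda>x. - ln (G x + \<epsilon>))"
    using s_pos(1) K(2) cG by (intro continuous_intros) force+
  then have cw: "continuous_on K (\<lambda>x. (- ln (G x + \<epsilon>)) powr (\<beta> * p))"
    using s_pos(2) K(2) by (intro continuous_on_powr continuous_on_const) force+
  have cs: "continuous_on K (\<lambda>x. (G x + \<epsilon>) powr p)"
    using s_pos(1) K(2) cG by (intro continuous_on_powr continuous_intros) force+
  have cNp: "continuous_on K (\<lambda>x. ?N x powr p)" and cBp: "continuous_on K (\<lambda>x. ?B x powr p)"
    using p cN cB
    by (intro continuous_on_powr' continuous_on_const; simp add: tangent_norm_nonneg[OF A g])+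
  have cfp: "continuous_on K (\<lambda>x. \<bar>f x\<bar> powr p)"
    using p cf by (intro continuous_on_powr' continuous_intros) auto
  have ca: "continuous_on K a"
    unfolding a_def using s_pos(1) K(2)
    by (intro continuous_on_mult continuous_on_divide cNp cs cw) force
  have cb: "continuous_on K b"
    unfolding b_def by (intro continuous_on_mult cBp cw)
  note integrable = set_integrable_compact[OF A g K(1)]
  have ia: "set_integrable ?M K a" by (rule integrable[OF ca])
  show iaf: "set_integrable ?M K (\<lambda>x. a x * \<bar>f x\<bar> powr p)"
    by (intro integrable continuous_on_mult ca cfp)
  show ib: "set_integrable ?M K b" by (rule integrable[OF cb])
  show "(LINT x:K|?M. a x * \<bar>f x\<bar> powr p) \<le> ?C * (LINT x:K|?M. b x)"
  proof (rule le_if_le_add_small)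
    fix e :: real assume e: "0 < e"
    \<comment> \<open>Chosen so that \<delta>^(p/2) = e / p: after the factor (p - 1) / p is taken
      out, the error is exactly e times the integral of a.\<close>
    define \<delta> where "\<delta> = (e / p) powr (2 / p)"
    have \<delta>: "0 < \<delta>" "\<delta> powr (p / 2) = e / p"
      using e p by (simp_all add: \<delta>_def powr_powr)
    define F where "F t = (t\<^sup>2 + \<delta>) powr (p / 2) - \<delta> powr (p / 2)" for t
    define H where "H t = (t + \<epsilon>) powr (1 - p) * (- ln (t + \<epsilon>)) powr (\<beta> * p)" for t
    define \<psi> where "\<psi> x = F (f x) * H (G x)" for x
    let ?I = "\<lambda>x. ?N x powr (p - 2) * tangent_inner A g x (gradient A g G x) (gradient A g \<psi> x)"
    let ?R = "\<lambda>x. (p - 1) * (e / p * a x + ?C * b x / p - a x * \<bar>f x\<bar> powr p / p)"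
    have F_deriv: "(F has_real_derivative p * (t\<^sup>2 + \<delta>) powr (p / 2 - 1) * t) (at t)" for t
    proof -
      have "0 < t\<^sup>2 + \<delta>" using \<delta>(1) by (simp add: add_nonneg_pos)
      moreover have "((\<lambda>t. t\<^sup>2 + \<delta>) has_real_derivative 2 * t) (at t)"
        by (auto intro!: derivative_eq_intros)
      ultimately have "((\<lambda>t. (t\<^sup>2 + \<delta>) powr (p / 2)) has_real_derivative
          p / 2 * (t\<^sup>2 + \<delta>) powr (p / 2 - 1) * (2 * t)) (at t)"
        by (intro DERIV_chain2[where f = "\<lambda>z. z powr (p / 2)"] has_real_derivative_powr)
      from DERIV_diff[OF this DERIV_const[of "\<delta> powr (p / 2)"]] show ?thesis
        by (simp add: F_def[abs_def] mult.assoc)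
    qed
    have H_deriv: "\<exists>H'. (H has_real_derivative H') (at (G x)) \<and>
        H' \<le> - ((p - 1) * (G x + \<epsilon>) powr (- p) * (- ln (G x + \<epsilon>)) powr (\<beta> * p))" if x: "x \<in> \<Omega>" for x
    proof -
      obtain H' where H': "((\<lambda>s. s powr (1 - p) * (- ln s) powr (\<beta> * p)) has_real_derivative H')
          (at (G x + \<epsilon>))"
        "H' \<le> - ((p - 1) * (G x + \<epsilon>) powr (- p) * (- ln (G x + \<epsilon>)) powr (\<beta> * p))"
        by (rule log_weight_deriv_bound[OF s_bounds[OF x] p \<beta>])
      then have "(H has_real_derivative H') (at (G x))"
        using DERIV_shift[of "\<lambda>s. s powr (1 - p) * (- ln s) powr (\<beta> * p)" H' "G x" \<epsilon>]
        by (simp add: H_def[abs_def])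
      with H'(2) show ?thesis by blast
    qed
    then obtain H' where H': "\<And>x. x \<in> \<Omega> \<Longrightarrow> (H has_real_derivative H' x) (at (G x))"
      "\<And>x. x \<in> \<Omega> \<Longrightarrow> H' x \<le> - ((p - 1) * (G x + \<epsilon>) powr (- p) * (- ln (G x + \<epsilon>)) powr (\<beta> * p))"
      by metis
    have grad: "gradient A g \<psi> x =
        (H (G x) * (p * ((f x)\<^sup>2 + \<delta>) powr (p / 2 - 1) * f x)) *\<^sub>R gradient A g f x +
        (F (f x) * H' x) *\<^sub>R gradient A g G x" if "x \<in> \<Omega>" for x
      unfolding \<psi>_def by (rule gradient_mult_comp[OF A that f' G F_deriv H'(1)[OF that]])
    have f_zero: "f x = 0" if "x \<in> \<Omega> - K" for x
      using that closure_subset[of "{x \<in> \<Omega>. f x \<noteq> 0}"] by (auto simp: K_def)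
    \<comment> \<open>Both coefficients in \<open>grad\<close> vanish with f: one has f as a factor,
      the other is F at 0, which is 0 by the subtracted constant. This lets the comparison below
      pass from \<Omega> to K.\<close>
    have zero: "gradient A g \<psi> x = 0" if "x \<in> \<Omega> - K" for x
      using that f_zero[OF that] by (simp add: grad F_def)
    have test: "test_fun A \<Omega> \<psi>"
      unfolding \<psi>_def F_def H_def by (rule test_fun_regularized[OF A \<Omega> G f s_bounds \<delta>(1)])
    have "0 \<le> \<psi> x" for x
      using \<delta>(1) p by (auto simp: \<psi>_def F_def H_def intro!: mult_nonneg_nonneg powr_mono2)
    with super test have "0 \<le> (LINT x:\<Omega>|?M. ?I x)"
      by (simp add: p_superharmonic_def)
    also have "\<dots> \<le> (LINT x:K|?M. ?R x)"
      unfolding set_lebesgue_integral_def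
    proof (rule integral_mono)
      show "integrable ?M (\<lambda>x. indicator \<Omega> x *\<^sub>R ?I x)"
        using integrable_p_Laplacian_pairing[OF A g \<Omega> p G _ K zero] test
        by (simp add: test_fun_def set_integrable_def)
      have "set_integrable ?M K ?R"
        using p by (intro integrable continuous_on_mult continuous_on_diff continuous_on_add
            continuous_on_divide continuous_on_const ca cb cfp) auto
      then show "integrable ?M (\<lambda>x. indicator K x *\<^sub>R ?R x)"
        by (simp add: set_integrable_def)
      fix x
      show "indicator \<Omega> x *\<^sub>R ?I x \<le> indicator K x *\<^sub>R ?R x"
      proof (cases "x \<in> K")
        case True
        then have x: "x \<in> \<Omega>" using K(2) by blast
        let ?w = "(- ln (G x + \<epsilon>)) powr (\<beta> * p)" and ?i = "tangent_inner A g x (gradient A g G x) (gradient A g f x)"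
        have "?I x = ?N x powr (p - 2) *
          ((G x + \<epsilon>) powr (1 - p) * ?w * (p * ((f x)\<^sup>2 + \<delta>) powr (p / 2 - 1) * f x) * ?i +
          (((f x)\<^sup>2 + \<delta>) powr (p / 2) - \<delta> powr (p / 2)) * H' x * (?N x)\<^sup>2)"
          unfolding grad[OF x] tangent_inner_linear tangent_inner_self[OF A g] F_def H_def ..
        also have "\<dots> \<le> (p - 1) * (\<delta> powr (p / 2) * (?N x powr p / (G x + \<epsilon>) powr p * ?w) +
            ?C * (?w * ?B x powr p) / p - ?N x powr p / (G x + \<epsilon>) powr p * ?w * \<bar>f x\<bar> powr p / p)"
          by (rule regularized_integrand_bound[OF p tangent_norm_nonneg[OF A g] tangent_norm_nonneg[OF A g]
              tangent_Cauchy_Schwarz[OF A g] s_pos(1)[OF x] _ \<delta>(1) H'(2)[OF x]]) simp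
        also have "\<dots> = ?R x"
          by (simp only: a_def b_def \<delta>(2))
        finally show ?thesis using True x by simp
      next
        case False
        then show ?thesis using zero[of x] by (auto simp: indicator_def tangent_inner_def)
      qed
    qed
    also have "\<dots> = (p - 1) / p * (e * (LINT x:K|?M. a x) + ?C * (LINT x:K|?M. b x)
        - (LINT x:K|?M. a x * \<bar>f x\<bar> powr p))"
    proof -
      have "(LINT x:K|?M. ?R x) = (LINT x:K|?M. (p - 1) / p * (e * a x + ?C * b x - a x * \<bar>f x\<bar> powr p))"
      proof -
        have "?R x = (p - 1) / p * (e * a x + ?C * b x - a x * \<bar>f x\<bar> powr p)" for x
          using p by (simp add: field_simps)
        then show ?thesis by (simp only:)
      qed
      also have "\<dots> = (p - 1) / p * (LINT x:K|?M. (e * a x + ?C * b x - a x * \<bar>f x\<bar> powr p))"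
        by (rule set_integral_mult_right)
      also have "(LINT x:K|?M. (e * a x + ?C * b x - a x * \<bar>f x\<bar> powr p)) =
          (LINT x:K|?M. (e * a x + ?C * b x)) - (LINT x:K|?M. a x * \<bar>f x\<bar> powr p)"
        using ia ib iaf by (intro set_integral_diff set_integral_add set_integrable_mult_right)
      also have "(LINT x:K|?M. (e * a x + ?C * b x)) = e * (LINT x:K|?M. a x) + ?C * (LINT x:K|?M. b x)"
        using ia ib by (subst set_integral_add) auto
      finally show ?thesis .
    qed
    finally have "0 \<le> e * (LINT x:K|?M. a x) + ?C * (LINT x:K|?M. b x)
        - (LINT x:K|?M. a x * \<bar>f x\<bar> powr p)"
      using p by (simp add: zero_le_mult_iff zero_le_divide_iff)
    then show "(LINT x:K|?M. a x * \<bar>f x\<bar> powr p) \<le> e * (LINT x:K|?M. a x) + ?C * (LINT x:K|?M. b x)"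
      by simp
  qed
qed

text \<open>Passing from the shifted value s down to t only enlarges the weight, up to \<infinity>
  at t = 0 when q > 0. The right-hand integral with t = G thus bounds every shifted one, uniformly
  in \<epsilon>.\<close>

lemma neg_log_pow_mono:
  assumes "0 \<le> t" "t \<le> s" "s < 1" "0 < s" "0 \<le> q"
  shows "ennreal ((- ln s) powr q) \<le> neg_log_pow q t"
proof (cases "t = 0")
  case True
  with assms show ?thesis by (simp add: neg_log_pow_def)
next
  case False
  with assms have "(- ln s) powr q \<le> (- ln t) powr q"
    by (intro powr_mono2) auto
  with False show ?thesis
    by (simp add: neg_log_pow_def ennreal_leI)
qed

theorem theorem3p1:
  fixes A :: "('a::{second_countable_topology,t2_space}, 'n::finite) chart set"
    and g :: "('a, 'n) metric_components"
    and \<Omega> :: "'a set"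
    and G f :: "'a \<Rightarrow> real"
    and p c \<beta> :: real
  assumes "complete_riemannian_manifold A g"
    and "open \<Omega>"
    and "1 < p"
    and "smooth_fun A \<Omega> G"
    and "p_superharmonic A g p \<Omega> G"
    and "c < 1"
    and "\<forall>x\<in>\<Omega>. 0 \<le> G x \<and> G x \<le> c"
    and "0 \<le> \<beta>"
    and "test_fun A \<Omega> f"
  shows "(\<integral>\<^sup>+x\<in>\<Omega>. (if G x = 0 then 0
              else ennreal (tangent_norm A g x (gradient A g G x) powr p / \<bar>G x\<bar> powr p *
                     (- ln (G x)) powr (\<beta> * p) * \<bar>f x\<bar> powr p)) \<partial>riemannian_volume A g)
         \<le> ennreal ((p / (p - 1)) powr p) *
            (\<integral>\<^sup>+x\<in>\<Omega>. neg_log_pow (\<beta> * p) (G x) *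
               ennreal (tangent_norm A g x (gradient A g f x) powr p) \<partial>riemannian_volume A g)"
proof -
  have A: "smooth_atlas A" and g: "riemannian_metric A g"
    using assms(1) by (simp_all add: complete_riemannian_manifold_def)
  define K where "K = closure {x \<in> \<Omega>. f x \<noteq> 0}"
  \<comment> \<open>The denominator n + 2 makes even the first shift strictly smaller than 1 - c, so
    G + \<epsilon> stays below 1.\<close>
  define \<epsilon> where "\<epsilon> n = (1 - c) / real (n + 2)" for n
  let ?M = "riemannian_volume A g"
  let ?N = "\<lambda>x. tangent_norm A g x (gradient A g G x)"
  let ?B = "\<lambda>x. tangent_norm A g x (gradient A g f x)"
  let ?C = "(p / (p - 1)) powr p"
  let ?R = "\<integral>\<^sup>+x\<in>\<Omega>. neg_log_pow (\<beta> * p) (G x) * ennreal (?B x powr p) \<partial>?M"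
  define u where "u n x = indicator K x *\<^sub>R
    (?N x powr p / (G x + \<epsilon> n) powr p * (- ln (G x + \<epsilon> n)) powr (\<beta> * p) * \<bar>f x\<bar> powr p)" for n x
  have K: "K \<subseteq> \<Omega>" using assms(9) by (simp add: test_fun_def K_def)
  have \<epsilon>_pos: "0 < \<epsilon> n" for n
    using assms(6) by (simp add: \<epsilon>_def)
  have \<epsilon>_less: "\<epsilon> n < 1 - c" for n
    using assms(6) divide_strict_left_mono[of 1 "real (n + 2)" "1 - c"] by (simp add: \<epsilon>_def)
  have s: "0 < G x + \<epsilon> n" "G x + \<epsilon> n < 1" if "x \<in> \<Omega>" for x n
    using assms(7) that \<epsilon>_pos[of n] \<epsilon>_less[of n] by (auto simp: add_nonneg_pos dest!: bspec)
  have \<epsilon>_lim: "\<epsilon> \<longlonglongrightarrow> 0"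
    unfolding \<epsilon>_def by real_asymp
  note reg = regularized_inequality[OF A g assms(2,3,4,5) s assms(8,9), folded K_def]
  have u_le: "(\<integral>\<^sup>+x. ennreal (u n x) \<partial>?M) \<le> ennreal ?C * ?R" for n
  proof -
    define b where "b x = indicator K x *\<^sub>R ((- ln (G x + \<epsilon> n)) powr (\<beta> * p) * ?B x powr p)" for x
    have b_le: "ennreal (b x) \<le> neg_log_pow (\<beta> * p) (G x) * ennreal (?B x powr p) * indicator \<Omega> x" for x
    proof (cases "x \<in> K")
      case True
      then have x: "x \<in> \<Omega>" using K by blast
      have "ennreal ((- ln (G x + \<epsilon> n)) powr (\<beta> * p)) \<le> neg_log_pow (\<beta> * p) (G x)"
        using assms(3,7,8) x \<epsilon>_pos[of n] by (intro neg_log_pow_mono s[OF x]) auto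
      then have "ennreal ((- ln (G x + \<epsilon> n)) powr (\<beta> * p)) * ennreal (?B x powr p)
          \<le> neg_log_pow (\<beta> * p) (G x) * ennreal (?B x powr p)"
        by (rule mult_right_mono) simp
      with True x show ?thesis by (simp add: b_def ennreal_mult)
    qed (simp add: b_def)
    have "(\<integral>\<^sup>+x. ennreal (u n x) \<partial>?M) = ennreal (\<integral>x. u n x \<partial>?M)"
      using reg(1)[of n] unfolding set_integrable_def u_def
      by (intro nn_integral_eq_integral) auto
    also have "\<dots> \<le> ennreal (?C * (\<integral>x. b x \<partial>?M))"
      using reg(3)[of n] unfolding set_lebesgue_integral_def u_def b_def by (intro ennreal_leI)
    also have "\<dots> = ennreal ?C * (\<integral>\<^sup>+x. ennreal (b x) \<partial>?M)"
    proof -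
      have "(\<integral>\<^sup>+x. ennreal (b x) \<partial>?M) = ennreal (\<integral>x. b x \<partial>?M)"
        using reg(2)[of n] unfolding set_integrable_def b_def
        by (intro nn_integral_eq_integral) auto
      then show ?thesis
        by (simp add: ennreal_mult b_def)
    qed
    also have "\<dots> \<le> ennreal ?C * ?R"
      by (intro mult_left_mono nn_integral_mono b_le) simp
    finally show ?thesis .
  qed
  have u_meas: "(\<lambda>x. ennreal (u n x)) \<in> borel_measurable ?M" for n
    using reg(1)[of n] unfolding set_integrable_def u_def by measurable
  have le_liminf: "(if G x = 0 then 0 else ennreal (?N x powr p / \<bar>G x\<bar> powr p *
      (- ln (G x)) powr (\<beta> * p) * \<bar>f x\<bar> powr p)) * indicator \<Omega> x \<le> liminf (\<lambda>n. ennreal (u n x))" for x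
  \<comment> \<open>Where G > 0 on the support the integrands converge as the shift vanishes.
    Elsewhere the left integrand is 0: by the indicator off \<Omega>, by convention at zeros of G,
    and because f = 0 off K.\<close>
  proof (cases "x \<in> \<Omega> \<and> G x \<noteq> 0 \<and> x \<in> K")
    case True
    then have G: "0 < G x" "G x < 1"
      using assms(6,7) by fastforce+
    have lim: "(\<lambda>n. G x + \<epsilon> n) \<longlonglongrightarrow> G x"
      using tendsto_add[OF tendsto_const[of "G x"] \<epsilon>_lim] by simp
    have "(\<lambda>n. u n x) \<longlonglongrightarrow> ?N x powr p / \<bar>G x\<bar> powr p * (- ln (G x)) powr (\<beta> * p) * \<bar>f x\<bar> powr p"
      using True G unfolding u_def by (auto intro!: tendsto_intros lim)
    then have "(\<lambda>n. ennreal (u n x)) \<longlonglongrightarrow>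
        ennreal (?N x powr p / \<bar>G x\<bar> powr p * (- ln (G x)) powr (\<beta> * p) * \<bar>f x\<bar> powr p)"
      by (rule tendsto_ennrealI)
    from lim_imp_Liminf[OF sequentially_bot this] show ?thesis
      using True by simp
  next
    case False
    then have "x \<notin> \<Omega> \<or> G x = 0 \<or> f x = 0"
      using closure_subset[of "{x \<in> \<Omega>. f x \<noteq> 0}"] by (auto simp: K_def)
    then have "(if G x = 0 then 0 else ennreal (?N x powr p / \<bar>G x\<bar> powr p *
      (- ln (G x)) powr (\<beta> * p) * \<bar>f x\<bar> powr p)) * indicator \<Omega> x = 0"
      by (elim disjE) simp_all
    then show ?thesis by (simp only: zero_le)
  qed
  have "(\<integral>\<^sup>+x\<in>\<Omega>. (if G x = 0 then 0 else ennreal (?N x powr p / \<bar>G x\<bar> powr p *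
      (- ln (G x)) powr (\<beta> * p) * \<bar>f x\<bar> powr p)) \<partial>?M) \<le> (\<integral>\<^sup>+x. liminf (\<lambda>n. ennreal (u n x)) \<partial>?M)"
    by (intro nn_integral_mono le_liminf)
  also have "\<dots> \<le> liminf (\<lambda>n. \<integral>\<^sup>+x. ennreal (u n x) \<partial>?M)"
    by (rule nn_integral_liminf[OF u_meas])
  also have "\<dots> \<le> ennreal ?C * ?R"
    by (rule Liminf_le[OF sequentially_bot]) (simp add: u_le)
  finally show ?thesis .
qed

end
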